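(* Let $G = \langle R \cup D \rangle$ be a constant spinal group, and let $H$ be a special prodense subgroup of $G$, conjugate in $G$ to $\langle R \cup T \rangle$ with $T\le D$ as in the definition of special subgroups, such that $H$ is regular branch over its commutator subgroup $H'$. Then $H$ is a maximal subgroup of $G$ if and only if $T$ is a maximal subgroup of $D$.
   Context: For a finite non-empty set $X$, $X^\ast$ denotes the rooted tree of finite words over $X$. $\mathrm{Aut}(X^\ast)$ is its automorphism group, acting on the left. For $g\in\mathrm{Aut}(X^\ast)$ and $v\in X^\ast$, the section $g|_v\in \mathrm{Aut}(X^\ast)$ is defined by $g(vu)=g(v)\,g|_v(u)$ for all $u\in X^\ast$. Constant spinal groups: let $R$ be a finite group with identity $e$, let $X=\underline{R}$ be its underlying set, and write $\underline{r}\in X$ for the letter corresponding to $r\in R$. The group $R$ acts on $X$ by $r\underline{s}=\underline{rs}$, and $r\in R$ is identified with the rooted automorphism $\underline{s}w\mapsto \underline{rs}\,w$ of $X^\ast$. An automorphism $d$ is directed if it fixes every word of length $1$, $d|_{\underline{e}}=d$, and $d|_x\in R$ for all $x\in X\smallsetminus\{\underline{e}\}$. Let $D$ be a group of directed automorphisms with (Gen): $\langle d|_x \mid d\in D,\ x\in X\smallsetminus\{\underline{e}\}\rangle = R$. Then $G=\langle R\cup D\rangle\le \mathrm{Aut}(X^\ast)$ is called a constant spinal group. A special subgroup of $G$ is a $G$-conjugate of a subgroup $\langle R\cup T\rangle$, where $T\le D$ is a subgroup that also satisfies (Gen), i.e. $\langle t|_x\mid t\in T,\ x\in X\smallsetminus\{\underline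 e\}\rangle=R$. A subgroup $H\le G$ is prodense if $HN=G$ for every non-trivial normal subgroup $N$ of $G$. For $h_x\in\mathrm{Aut}(X^\ast)$ $(x\in X)$, $(x:h_x)_{x\in X}$ denotes the automorphism fixing the first layer $X$ pointwise with section $h_x$ at $x$. A group $H$ acting spherically transitively (transitively on each $X^n$) is regular branch over a finite index subgroup $K\le H$ if $\{(x:k_x)_{x\in X}\mid k_x\in K\}$ is contained in $K$ as a subgroup of finite index. *)

theory Defs
  imports "HOL-Algebra.Bij" "HOL-Algebra.Generated_Groups"
begin

text \<open>
  The vertices of the rooted tree of words over \<open>X\<close> are the elements of \<^term>\<open>lists X\<close>, with root
  the empty word; a word is joined by an edge to each of its one-letter extensions.  As in
  \<^const>\<open>BijGroup\<close>, automorphisms are extensional functions on the vertex set, composed so that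
  they act from the left.
\<close>

definition tree_adj :: "'a list \<Rightarrow> 'a list \<Rightarrow> bool" where
  "tree_adj u v \<longleftrightarrow> (\<exists>x. v = u @ [x]) \<or> (\<exists>x. u = v @ [x])"

definition tree_auto :: "'a set \<Rightarrow> ('a list \<Rightarrow> 'a list) set" where
  "tree_auto X = {g \<in> Bij (lists X). g [] = [] \<and>
     (\<forall>u \<in> lists X. \<forall>v \<in> lists X. tree_adj (g u) (g v) \<longleftrightarrow> tree_adj u v)}"

definition tree_Aut :: "'a set \<Rightarrow> ('a list \<Rightarrow> 'a list) monoid" where
  "tree_Aut X = (BijGroup (lists X))\<lparr>carrier := tree_auto X\<rparr>"

text \<open>
  Automorphisms preserve the length of words, so the section of \<open>g\<close> at \<open>v\<close> is obtained by deleting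
  the first \<^term>\<open>length v\<close> letters of \<^term>\<open>g (v @ u)\<close>; the characterising equation is
  \<open>tree_section_eq\<close> below.
\<close>

definition tree_section :: "'a set \<Rightarrow> ('a list \<Rightarrow> 'a list) \<Rightarrow> 'a list \<Rightarrow> 'a list \<Rightarrow> 'a list" where
  "tree_section X g v = (\<lambda>u \<in> lists X. drop (length v) (g (v @ u)))"

definition first_layer :: "'a set \<Rightarrow> ('a \<Rightarrow> 'a list \<Rightarrow> 'a list) \<Rightarrow> 'a list \<Rightarrow> 'a list" where
  "first_layer X h = (\<lambda>w \<in> lists X. case w of [] \<Rightarrow> [] | x # u \<Rightarrow> x # h x u)"

definition spherically_transitive :: "'a set \<Rightarrow> ('a list \<Rightarrow> 'a list) set \<Rightarrow> bool" where
  "spherically_transitive X H \<longleftrightarrow>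
     (\<forall>u \<in> lists X. \<forall>v \<in> lists X. length u = length v \<longrightarrow> (\<exists>h \<in> H. h u = v))"

definition finite_index :: "('g, 'm) monoid_scheme \<Rightarrow> 'g set \<Rightarrow> bool" where
  "finite_index G K \<longleftrightarrow> subgroup K G \<and> finite (rcosets\<^bsub>G\<^esub> K)"

definition regular_branch_over ::
  "'a set \<Rightarrow> ('a list \<Rightarrow> 'a list) set \<Rightarrow> ('a list \<Rightarrow> 'a list) set \<Rightarrow> bool" where
  "regular_branch_over X H K \<longleftrightarrow>
     subgroup H (tree_Aut X) \<and> spherically_transitive X H \<and>
     finite_index (tree_Aut X\<lparr>carrier := H\<rparr>) K \<and>
     finite_index (tree_Aut X\<lparr>carrier := K\<rparr>) {first_layer X k |k. \<forall>x \<in> X. k x \<in> K}"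

definition maximal_subgroup :: "'g set \<Rightarrow> ('g, 'm) monoid_scheme \<Rightarrow> bool" where
  "maximal_subgroup M G \<longleftrightarrow> subgroup M G \<and> M \<noteq> carrier G \<and>
     (\<forall>L. subgroup L G \<and> M \<subseteq> L \<longrightarrow> L = M \<or> L = carrier G)"

definition prodense :: "'g set \<Rightarrow> ('g, 'm) monoid_scheme \<Rightarrow> bool" where
  "prodense H G \<longleftrightarrow> subgroup H G \<and>
     (\<forall>N. N \<lhd> G \<and> N \<noteq> {\<one>\<^bsub>G\<^esub>} \<longrightarrow> H <#>\<^bsub>G\<^esub> N = carrier G)"

text \<open>The alphabet of a constant spinal group is \<^term>\<open>carrier R\<close>.\<close>

definition rooted :: "('a, 'm) monoid_scheme \<Rightarrow> 'a \<Rightarrow> 'a list \<Rightarrow> 'a list" where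
  "rooted R r = (\<lambda>w \<in> lists (carrier R). case w of [] \<Rightarrow> [] | s # u \<Rightarrow> (r \<otimes>\<^bsub>R\<^esub> s) # u)"

definition rooted_group :: "('a, 'm) monoid_scheme \<Rightarrow> ('a list \<Rightarrow> 'a list) set" where
  "rooted_group R = rooted R ` carrier R"

definition directed :: "('a, 'm) monoid_scheme \<Rightarrow> ('a list \<Rightarrow> 'a list) \<Rightarrow> bool" where
  "directed R d \<longleftrightarrow> d \<in> tree_auto (carrier R) \<and> (\<forall>x \<in> carrier R. d [x] = [x]) \<and>
     tree_section (carrier R) d [\<one>\<^bsub>R\<^esub>] = d \<and>
     (\<forall>x \<in> carrier R - {\<one>\<^bsub>R\<^esub>}. tree_section (carrier R) d [x] \<in> rooted_group R)"

definition Gen :: "('a, 'm) monoid_scheme \<Rightarrow> ('a list \<Rightarrow> 'a list) set \<Rightarrow> bool" where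
  "Gen R D \<longleftrightarrow> generate (tree_Aut (carrier R))
      {tree_section (carrier R) d [x] |d x. d \<in> D \<and> x \<in> carrier R - {\<one>\<^bsub>R\<^esub>}} = rooted_group R"

definition spinal_set :: "('a, 'm) monoid_scheme \<Rightarrow> ('a list \<Rightarrow> 'a list) set \<Rightarrow> ('a list \<Rightarrow> 'a list) set" where
  "spinal_set R D = generate (tree_Aut (carrier R)) (rooted_group R \<union> D)"

definition spinal_group :: "('a, 'm) monoid_scheme \<Rightarrow> ('a list \<Rightarrow> 'a list) set \<Rightarrow> ('a list \<Rightarrow> 'a list) monoid" where
  "spinal_group R D = tree_Aut (carrier R)\<lparr>carrier := spinal_set R D\<rparr>"

definition constant_spinal :: "('a, 'm) monoid_scheme \<Rightarrow> ('a list \<Rightarrow> 'a list) set \<Rightarrow> bool" where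
  "constant_spinal R D \<longleftrightarrow> group R \<and> finite (carrier R) \<and>
     subgroup D (tree_Aut (carrier R)) \<and> (\<forall>d \<in> D. directed R d) \<and> Gen R D"

text \<open>
  A special subgroup together with a subgroup \<open>T\<close> of \<open>D\<close> from which it arises; \<open>H\<close> is special if
  such a \<open>T\<close> exists.
\<close>

definition special_from :: "('a, 'm) monoid_scheme \<Rightarrow> ('a list \<Rightarrow> 'a list) set \<Rightarrow>
    ('a list \<Rightarrow> 'a list) set \<Rightarrow> ('a list \<Rightarrow> 'a list) set \<Rightarrow> bool" where
  "special_from R D T H \<longleftrightarrow>
     subgroup T (tree_Aut (carrier R)\<lparr>carrier := D\<rparr>) \<and> Gen R T \<and>
     (\<exists>g \<in> carrier (spinal_group R D).
        H = g <#\<^bsub>spinal_group R D\<^esub> spinal_set R T #>\<^bsub>spinal_group R D\<^esub> inv\<^bsub>spinal_group R D\<^esub> g)"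

lemma tree_auto_lists: "g \<in> tree_auto X \<Longrightarrow> v \<in> lists X \<Longrightarrow> g v \<in> lists X"
  unfolding tree_auto_def Bij_def bij_betw_def by blast

lemma tree_auto_inj:
  "g \<in> tree_auto X \<Longrightarrow> u \<in> lists X \<Longrightarrow> v \<in> lists X \<Longrightarrow> g u = g v \<longleftrightarrow> u = v"
  unfolding tree_auto_def Bij_def bij_betw_def by (auto dest: inj_onD)

lemma subgroup_tree_auto: "subgroup (tree_auto X) (BijGroup (lists X))"
proof -
  interpret B: group "BijGroup (lists X)" by (rule group_BijGroup)
  have inv_eq: "inv\<^bsub>BijGroup (lists X)\<^esub> g = (\<lambda>x \<in> lists X. inv_into (lists X) g x)"
    if "g \<in> Bij (lists X)" for g
    by (rule inv_BijGroup[OF that])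
  show ?thesis
  proof
    show "tree_auto X \<subseteq> carrier (BijGroup (lists X))"
      by (auto simp: tree_auto_def BijGroup_def)
    show "\<one>\<^bsub>BijGroup (lists X)\<^esub> \<in> tree_auto X"
      using id_Bij[of "lists X"] by (auto simp: tree_auto_def BijGroup_def)
  next
    fix g h assume g: "g \<in> tree_auto X" and h: "h \<in> tree_auto X"
    have "compose (lists X) g h \<in> Bij (lists X)"
      using g h by (auto simp: tree_auto_def intro: compose_Bij)
    then show "g \<otimes>\<^bsub>BijGroup (lists X)\<^esub> h \<in> tree_auto X"
      using g h tree_auto_lists[OF h]
      by (auto simp: tree_auto_def BijGroup_def compose_def)
  next
    fix g assume g: "g \<in> tree_auto X"
    then have b: "g \<in> Bij (lists X)" by (simp add: tree_auto_def)
    let ?i = "\<lambda>x \<in> lists X. inv_into (lists X) g x"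
    have mem: "?i u \<in> lists X" and gi: "g (?i u) = u" if "u \<in> lists X" for u
      using that b by (auto simp: Bij_inv_into_mem Bij_def bij_betw_def f_inv_into_f)
    have "?i [] = []"
      using b g unfolding tree_auto_def Bij_def bij_betw_def
      by (auto intro!: inv_into_f_eq)
    moreover have "tree_adj (?i u) (?i v) \<longleftrightarrow> tree_adj u v"
      if "u \<in> lists X" "v \<in> lists X" for u v
    proof -
      have "tree_adj (g (?i u)) (g (?i v)) \<longleftrightarrow> tree_adj (?i u) (?i v)"
        using g mem[OF that(1)] mem[OF that(2)] unfolding tree_auto_def by blast
      then show ?thesis using gi[OF that(1)] gi[OF that(2)] by simp
    qed
    ultimately show "inv\<^bsub>BijGroup (lists X)\<^esub> g \<in> tree_auto X"
      unfolding inv_eq[OF b] using restrict_inv_into_Bij[OF b]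
      unfolding tree_auto_def by blast
  qed
qed

lemma group_tree_Aut: "group (tree_Aut X)"
  unfolding tree_Aut_def
  by (rule group.subgroup_imp_group[OF group_BijGroup subgroup_tree_auto])

lemma tree_auto_snoc:
  assumes g: "g \<in> tree_auto X" and "u @ [x] \<in> lists X"
  shows "\<exists>y. g (u @ [x]) = g u @ [y]"
  using assms(2)
proof (induction u arbitrary: x rule: rev_induct)
  case Nil
  then have "[] \<in> lists X" "[x] \<in> lists X" by auto
  moreover have "tree_adj [] [x]" by (simp add: tree_adj_def)
  ultimately have "tree_adj (g []) (g [x])"
    using g unfolding tree_auto_def by blast
  then show ?case using g by (auto simp: tree_auto_def tree_adj_def)
next
  case (snoc a u)
  let ?v = "u @ [a]"
  have in_X: "u \<in> lists X" "?v \<in> lists X" "?v @ [x] \<in> lists X" using snoc.prems by auto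
  obtain y where y: "g ?v = g u @ [y]" using snoc.IH in_X by blast
  have "tree_adj (g ?v) (g (?v @ [x]))"
  proof -
    have "tree_adj ?v (?v @ [x])" by (auto simp: tree_adj_def)
    with g in_X show ?thesis unfolding tree_auto_def by blast
  qed
  then consider z where "g (?v @ [x]) = g ?v @ [z]" | z where "g ?v = g (?v @ [x]) @ [z]"
    unfolding tree_adj_def by blast
  then show ?case
  proof cases
    case 2
    then have "g (?v @ [x]) = g u" using y by simp
    then have "?v @ [x] = u" using tree_auto_inj[OF g in_X(3) in_X(1)] by simp
    then have "length (?v @ [x]) = length u" by (rule arg_cong)
    then show ?thesis by simp
  qed blast
qed

lemma tree_auto_prefix:
  assumes g: "g \<in> tree_auto X" and "v @ u \<in> lists X"
  shows "\<exists>w. length w = length u \<and> g (v @ u) = g v @ w"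
  using assms(2)
proof (induction u rule: rev_induct)
  case (snoc x u)
  then obtain w where w: "length w = length u" "g (v @ u) = g v @ w" by auto
  obtain y where "g ((v @ u) @ [x]) = g (v @ u) @ [y]"
    using tree_auto_snoc[OF g, of "v @ u" x] snoc.prems by auto
  with w show ?case by (intro exI[of _ "w @ [y]"]) simp
qed simp

lemma tree_auto_length:
  assumes "g \<in> tree_auto X" and "v \<in> lists X"
  shows "length (g v) = length v"
proof -
  have "g [] = []" using assms(1) by (simp add: tree_auto_def)
  with tree_auto_prefix[OF assms(1), of "[]" v] assms(2) show ?thesis by auto
qed

lemma tree_section_eq:
  assumes "g \<in> tree_auto X" and "v \<in> lists X" and "u \<in> lists X"
  shows "g (v @ u) = g v @ tree_section X g v u"
  using tree_auto_prefix[OF assms(1), of v u] tree_auto_length[OF assms(1,2)] assms(2,3)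
  by (auto simp: tree_section_def)

end

theory Submission
  imports Defs "HOL-Algebra.Multiplicative_Group"
begin

text \<open>
  Write \<open>H0\<close> for the subgroup generated by the rooted group and \<open>T\<close>, \<open>Hd\<close> for its commutator
  subgroup, and let \<open>H = g H0 g\<inverse>\<close>.  Everything rests on contraction: the sections of an element
  of a group generated by rooted and directed automorphisms, taken on a sufficiently deep layer,
  are rooted or directed (\<open>span_deep\<close>).  As a directed element equals its own section at the
  identity letter, a directed element of \<open>H0\<close> lies in \<open>T\<close> (\<open>D_Int_H0\<close>).  The same holds for every
  subgroup between \<open>T\<close> and \<open>D\<close>, so such a subgroup can be read off from the group that it generates
  together with the rooted elements, and maximality of \<open>H\<close> passes to \<open>T\<close> (\<open>T_maximal\<close>).

  For the converse let \<open>T\<close> be maximal in \<open>D\<close>.  Multiplying the classes of the directed sections on a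
  deep layer extends the map from \<open>D\<close> to its abelianization to the whole group
  (\<open>extend_to_deep\<close>).  The kernel of the extension contains the rooted group, so prodensity yields
  \<open>D = T D'\<close>; as \<open>T \<noteq> D\<close>, the group \<open>D\<close>, and with it \<open>R\<close>, is not abelian
  (\<open>RGd_nontrivial\<close>).  A non-trivial rooted commutator is then available throughout.

  Let \<open>M\<close> be a proper subgroup of the constant spinal group \<open>G\<close> with \<open>H0 \<subseteq> M\<close>.  The group
  \<open>M1\<close> of first-layer sections, at the identity letter, of the elements of \<open>M\<close> fixing that letter again satisfies \<open>H0 \<subseteq> M1 \<noteq> G\<close>
  (\<open>sections_ne_span\<close>): if \<open>M1 = G\<close>, then the rigid part of \<open>M\<close> at that letter is normal in \<open>G\<close>, the
  power of it over the first layer is a non-trivial normal subgroup of \<open>G\<close> inside \<open>M\<close>, and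
  prodensity gives \<open>M = G\<close>.  Descending along the layers, an element of \<open>M\<close> acquires sections that
  are rooted or directed, and a directed one must lie in \<open>T\<close>, since otherwise maximality of \<open>T\<close> would
  make the corresponding section group contain \<open>D\<close>.  So the deep sections of the elements of \<open>M\<close> lie
  in \<open>H0\<close> (\<open>proper_overgroup_trivial\<close>).

  It remains to climb up again: an element of \<open>G\<close> all of whose first-layer sections lie in \<open>H0\<close> belongs
  to \<open>H0\<close> (\<open>mem_of_sections\<close>).  By prodensity the sections can be taken in \<open>H0 \<inter> G'\<close>, and the
  extended abelianization maps show that such an element is a product of an element of \<open>T \<inter> D'\<close>
  and an element of \<open>Hd\<close> (\<open>H0_Int_derived_span\<close>).  The factors in \<open>T \<inter> D'\<close> are removed by elements of
  \<open>H0\<close> whose other sections are rooted commutators, and what is left has all its sections in \<open>Hd\<close>.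
  If \<open>H0\<close> is regular branch over \<open>Hd\<close>, this remainder lies in \<open>Hd\<close>.

  The hypothesis, however, says that the conjugate \<open>H\<close> is regular branch over \<open>H'\<close>, and branching is
  a statement about fixed coordinates, which conjugation by \<open>g\<close> does not obviously preserve.  It does
  here because \<open>g Hd g\<inverse> = Hd\<close> (\<open>Hg_eq_Hd\<close>).  Descending to a deep section of \<open>g\<close> that is
  rooted shows first that \<open>g Hd g\<inverse>\<close> is contained in \<open>H0\<close>, and then, by looking at conjugates of a
  rooted commutator, that all deep sections of \<open>g\<close> lie in \<open>H0\<close>.  The abelianization maps of \<open>H0\<close>
  therefore extend to a group containing \<open>g\<close>, and \<open>g Hd g\<inverse> \<subseteq> Hd\<close> follows.  Finally, the finiteness of
  the indices in the branch condition provides a power of \<open>g\<close> in \<open>Hd\<close>, which turns the inclusion into an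
  equality.
\<close>

section \<open>Commutators, abelianizations and conjugation in groups\<close>

lemma (in group) hom_derived_one:
  assumes U: "subgroup U G" and V: "V \<subseteq> U" and B: "comm_group B"
    and f: "f \<in> hom (G\<lparr>carrier := U\<rparr>) B" and k: "k \<in> derived G V"
  shows "f k = \<one>\<^bsub>B\<^esub>"
proof -
  interpret B: comm_group B by (rule B)
  interpret GU: group "G\<lparr>carrier := U\<rparr>" by (rule subgroup_imp_group[OF U])
  interpret f: group_hom "G\<lparr>carrier := U\<rparr>" B f
    using f by unfold_locales
  have "derived B (f ` V) = {\<one>\<^bsub>B\<^esub>}"
    using V f by (intro B.derived_eq_singleton) (auto simp: hom_def)
  moreover have "derived B (f ` V) = f ` derived (G\<lparr>carrier := U\<rparr>) V"
    using V by (intro f.derived_img) simp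
  moreover have "derived (G\<lparr>carrier := U\<rparr>) V = derived G V"
    by (rule derived_consistent[OF V U])
  ultimately show ?thesis using k by (metis imageI singletonD)
qed

lemma (in group) abelianization:
  assumes S: "subgroup S G"
  obtains B :: "'a set monoid" and q where "comm_group B" "q \<in> hom (G\<lparr>carrier := S\<rparr>) B"
    "\<And>s. s \<in> S \<Longrightarrow> q s = \<one>\<^bsub>B\<^esub> \<longleftrightarrow> s \<in> derived G S"
proof
  let ?S = "G\<lparr>carrier := S\<rparr>"
  let ?B = "?S Mod derived G S" and ?q = "\<lambda>s. derived G S #>\<^bsub>?S\<^esub> s"
  interpret S: group ?S by (rule subgroup_imp_group[OF S])
  have eq: "derived ?S (carrier ?S) = derived G S"
    using derived_consistent[OF _ S] by simp
  show "comm_group ?B" using S.derived_quot_is_comm_group unfolding eq .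
  interpret N: normal "derived G S" ?S using derived_subgroup_is_normal[OF S] .
  show "?q \<in> hom ?S ?B" by (rule N.r_coset_hom_Mod)
  show "?q s = \<one>\<^bsub>?B\<^esub> \<longleftrightarrow> s \<in> derived G S" if "s \<in> S" for s
    using that S.coset_join1[of "derived G S" s] S.coset_join2[of s "derived G S"] N.subgroup_axioms
    by (auto simp: FactGroup_def)
qed

lemma (in group) finite_index_pow:
  assumes "finite_index G K" and h: "h \<in> carrier G"
  obtains b :: nat where "b \<ge> 1" "h [^] b \<in> K"
proof -
  have K: "subgroup K G" and fin: "finite (rcosets K)"
    using assms by (auto simp: finite_index_def)
  interpret K: subgroup K G by (rule K)
  let ?f = "\<lambda>i::nat. K #> (h [^] i)"
  have "range ?f \<subseteq> rcosets K"
    using h by (auto intro!: rcosetsI K.subset)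
  then have "finite (range ?f)" using fin finite_subset by blast
  then have "\<not> inj ?f" using finite_imageD infinite_UNIV_nat by blast
  then obtain i j where ij: "i < j" "?f i = ?f j"
    by (metis linorder_injI)
  have "h [^] j \<in> ?f i"
    unfolding ij(2) by (rule rcos_self[OF _ K]) (simp add: h)
  then obtain k where k: "k \<in> K" "h [^] j = k \<otimes> h [^] i"
    by (auto simp: r_coset_def)
  have "h [^] (j - i) \<otimes> h [^] i = h [^] j"
    using ij(1) h nat_pow_mult[of h "j - i" i] by simp
  then have "h [^] (j - i) = k"
    using k h by (metis right_cancel K.mem_carrier nat_pow_closed)
  then show ?thesis using that[of "j - i"] ij k by simp
qed

lemma (in group) derived_conj:
  assumes S: "subgroup S G" and "k \<in> derived G S" "s \<in> S"
  shows "s \<otimes> k \<otimes> inv s \<in> derived G S"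
proof -
  interpret N: normal "derived G S" "G\<lparr>carrier := S\<rparr>" by (rule derived_subgroup_is_normal[OF S])
  show ?thesis using N.inv_op_closed2[of s k] assms by (simp add: m_inv_consistent)
qed

lemma (in group) commutator_mem_derived:
  "a \<in> S \<Longrightarrow> b \<in> S \<Longrightarrow> a \<otimes> b \<otimes> inv a \<otimes> inv b \<in> derived G S"
  unfolding derived_def by (intro generate.incl) blast

lemma (in group) hom_conj:
  assumes U: "subgroup U G" and B: "comm_group B" and f: "f \<in> hom (G\<lparr>carrier := U\<rparr>) B"
    and "c \<in> U" "k \<in> U"
  shows "f (c \<otimes> k \<otimes> inv c) = f k"
proof -
  interpret U: subgroup U G by (rule U)
  interpret B: comm_group B by (rule B)
  interpret f: group_hom "G\<lparr>carrier := U\<rparr>" B f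
    using f by (intro group_hom.intro group_hom_axioms.intro subgroup_imp_group U) (rule B.group_axioms)
  have c: "f c \<in> carrier B" "f k \<in> carrier B" using assms f.hom_closed by simp_all
  have "f (c \<otimes> k \<otimes> inv c) = f c \<otimes>\<^bsub>B\<^esub> f k \<otimes>\<^bsub>B\<^esub> inv\<^bsub>B\<^esub> f c"
    using assms f.hom_mult[of "c \<otimes> k" "inv c"] f.hom_mult[of c k] f.hom_inv[of c]
    by (simp add: m_inv_consistent)
  also have "\<dots> = f k" using c by (metis B.inv_solve_right' B.m_comm B.m_closed)
  finally show ?thesis .
qed

lemma (in group) hom_mono:
  "f \<in> hom (G\<lparr>carrier := U\<rparr>) B \<Longrightarrow> V \<subseteq> U \<Longrightarrow> f \<in> hom (G\<lparr>carrier := V\<rparr>) B"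
  by (auto simp: hom_def)

lemma (in group) normal_in_subgroupI:
  assumes U: "subgroup U G" and N: "subgroup N G" "N \<subseteq> U"
    and conj: "\<And>u n. u \<in> U \<Longrightarrow> n \<in> N \<Longrightarrow> u \<otimes> n \<otimes> inv u \<in> N"
  shows "N \<lhd> G\<lparr>carrier := U\<rparr>"
proof -
  interpret U: group "G\<lparr>carrier := U\<rparr>" by (rule subgroup_imp_group[OF U])
  have "subgroup N (G\<lparr>carrier := U\<rparr>)" using subgroup_incl[OF N(1) U N(2)] .
  then show ?thesis
    unfolding U.normal_inv_iff using conj by (simp add: m_inv_consistent[OF U])
qed

lemma (in group) pow_mem_mult:
  assumes "subgroup B G" "u \<in> carrier G" "u [^] (b::nat) \<in> B" "b dvd c"
  shows "u [^] c \<in> B"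
proof -
  interpret B: subgroup B G by (rule assms(1))
  obtain d where "c = b * d" using assms(4) by (rule dvdE)
  then have "u [^] c = (u [^] b) [^] d" using assms(2) by (simp add: nat_pow_pow)
  moreover have "(u [^] b) [^] d \<in> B" using assms(3) by (induction d) auto
  ultimately show ?thesis by simp
qed

lemma (in group) conj_mult:
  assumes "c \<in> carrier G" "a \<in> carrier G" "b \<in> carrier G"
  shows "c \<otimes> (a \<otimes> b) \<otimes> inv c = (c \<otimes> a \<otimes> inv c) \<otimes> (c \<otimes> b \<otimes> inv c)"
proof -
  have "inv c \<otimes> (c \<otimes> (b \<otimes> inv c)) = b \<otimes> inv c"
    using assms by (simp add: m_assoc[symmetric])
  then show ?thesis using assms by (simp add: m_assoc)
qed

lemma (in group) subgroup_conj:
  assumes S: "subgroup S G" and c: "c \<in> carrier G"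
  shows "subgroup ((\<lambda>k. c \<otimes> k \<otimes> inv c) ` S) G"
proof -
  have "group_hom G G (\<lambda>k. c \<otimes> k \<otimes> inv c)"
    using c conj_mult[OF c] by unfold_locales (simp add: hom_def)
  then show ?thesis using S by (rule group_hom.subgroup_img_is_subgroup)
qed

lemma (in group) conj_conj_inv:
  assumes "c \<in> carrier G" "L \<subseteq> carrier G"
  shows "(\<lambda>k. inv c \<otimes> k \<otimes> inv (inv c)) ` (\<lambda>k. c \<otimes> k \<otimes> inv c) ` L = L"
proof -
  have "inv c \<otimes> (c \<otimes> k \<otimes> inv c) \<otimes> inv (inv c) = k" if "k \<in> L" for k
    using assms that by (auto simp: m_assoc inv_solve_left' subset_iff)
  then show ?thesis by (simp add: image_image)
qed

lemma (in group) maximal_subgroup_restrict: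
  assumes U: "subgroup U G"
  shows "maximal_subgroup M (G\<lparr>carrier := U\<rparr>) \<longleftrightarrow> subgroup M G \<and> M \<subseteq> U \<and> M \<noteq> U \<and>
    (\<forall>L. subgroup L G \<longrightarrow> M \<subseteq> L \<longrightarrow> L \<subseteq> U \<longrightarrow> L = M \<or> L = U)"
proof -
  have "subgroup L (G\<lparr>carrier := U\<rparr>) \<longleftrightarrow> subgroup L G \<and> L \<subseteq> U" for L
    using incl_subgroup[OF U] subgroup_incl[OF _ U] subgroup.subset[of L "G\<lparr>carrier := U\<rparr>"] by auto
  then show ?thesis unfolding maximal_subgroup_def by auto
qed

lemma (in group) maximal_subgroup_conj:
  assumes U: "subgroup U G" and c: "c \<in> U" and M: "maximal_subgroup M (G\<lparr>carrier := U\<rparr>)"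
  shows "maximal_subgroup ((\<lambda>k. c \<otimes> k \<otimes> inv c) ` M) (G\<lparr>carrier := U\<rparr>)"
proof -
  interpret U: subgroup U G by (rule U)
  let ?c = "\<lambda>k. c \<otimes> k \<otimes> inv c" and ?d = "\<lambda>k. inv c \<otimes> k \<otimes> inv (inv c)"
  have cG: "c \<in> carrier G" "inv c \<in> carrier G" using c by auto
  have dc: "?d ` ?c ` L = L" if "L \<subseteq> carrier G" for L by (rule conj_conj_inv[OF cG(1) that])
  have cd: "?c ` ?d ` L = L" if "L \<subseteq> carrier G" for L
    using conj_conj_inv[OF cG(2) that] cG by simp
  have cU: "?c ` L \<subseteq> U" "?d ` L \<subseteq> U" if "L \<subseteq> U" for L using that c by auto
  have "?c ` ?d ` U \<subseteq> ?c ` U" by (rule image_mono[OF cU(2)[OF order_refl]])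
  then have U_eq: "?c ` U = U" unfolding cd[OF U.subset] by (rule equalityI[OF cU(1)[OF order_refl]])
  note max' = M[unfolded maximal_subgroup_restrict[OF U]]
  then have max: "subgroup M G" "M \<subseteq> U" "M \<noteq> U" by simp_all
  have max_L: "L = M \<or> L = U" if "subgroup L G" "M \<subseteq> L" "L \<subseteq> U" for L
    using max' that by simp
  have "?c ` M \<noteq> U"
  proof
    assume "?c ` M = U"
    then have "?d ` ?c ` M = ?d ` ?c ` U" by (simp only: U_eq)
    moreover have "?d ` ?c ` M = M" "?d ` ?c ` U = U" using max(2) U.subset by (intro dc; blast)+
    ultimately show False using max(3) by (simp only:)
  qed
  moreover have "L = ?c ` M \<or> L = U" if L: "subgroup L G" "?c ` M \<subseteq> L" "L \<subseteq> U" for L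
  proof -
    have LG: "L \<subseteq> carrier G" using L(1) by (rule subgroup.subset)
    have "?d ` ?c ` M \<subseteq> ?d ` L" using L(2) by (rule image_mono)
    moreover have "?d ` ?c ` M = M" using max(2) U.subset by (intro dc) blast
    ultimately have "M \<subseteq> ?d ` L" by (simp only:)
    moreover have "subgroup (?d ` L) G" by (rule subgroup_conj[OF L(1) cG(2)])
    ultimately have "?d ` L = M \<or> ?d ` L = U" using cU(2)[OF L(3)] by (intro max_L)
    then have "?c ` ?d ` L = ?c ` M \<or> ?c ` ?d ` L = ?c ` U" by (rule disj_forward) (erule arg_cong)+
    then show ?thesis unfolding cd[OF LG] U_eq .
  qed
  ultimately show ?thesis
    unfolding maximal_subgroup_restrict[OF U]
    using subgroup_conj[OF max(1) cG(1)] cU(1)[OF max(2)] by blast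
qed

section \<open>Automorphisms through their action on the first layer\<close>

text \<open>
  The arguments use a tree automorphism only through its permutation of the first layer and its
  first-layer sections, so these are taken as the primitives: \<open>act g x\<close> is the image of the
  letter \<open>x\<close>, \<open>sec g x\<close> the section at \<open>x\<close>, \<open>fl k\<close> the automorphism \<open>(x : k x)\<close>, and \<open>rt r\<close> the
  rooted automorphism of \<open>r\<close>.  Deeper layers are reached by iteration.
\<close>

locale wreath_recursion = group A + R: group R
  for A :: "('g, 'n) monoid_scheme" (structure) and R :: "('a, 'm) monoid_scheme" +
  fixes act :: "'g \<Rightarrow> 'a \<Rightarrow> 'a" and sec :: "'g \<Rightarrow> 'a \<Rightarrow> 'g"
    and fl :: "('a \<Rightarrow> 'g) \<Rightarrow> 'g" and rt :: "'a \<Rightarrow> 'g"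
  assumes finite_X: "finite (carrier R)"
    and act_closed [simp]: "g \<in> carrier A \<Longrightarrow> x \<in> carrier R \<Longrightarrow> act g x \<in> carrier R"
    and sec_closed [simp]: "g \<in> carrier A \<Longrightarrow> x \<in> carrier R \<Longrightarrow> sec g x \<in> carrier A"
    and act_one [simp]: "x \<in> carrier R \<Longrightarrow> act \<one> x = x"
    and act_mult [simp]: "g \<in> carrier A \<Longrightarrow> h \<in> carrier A \<Longrightarrow> x \<in> carrier R \<Longrightarrow>
           act (g \<otimes> h) x = act g (act h x)"
    and sec_mult [simp]: "g \<in> carrier A \<Longrightarrow> h \<in> carrier A \<Longrightarrow> x \<in> carrier R \<Longrightarrow>
           sec (g \<otimes> h) x = sec g (act h x) \<otimes> sec h x"
    and wreath_eqI: "g \<in> carrier A \<Longrightarrow> h \<in> carrier A \<Longrightarrow>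
           (\<And>x. x \<in> carrier R \<Longrightarrow> act g x = act h x) \<Longrightarrow>
           (\<And>x. x \<in> carrier R \<Longrightarrow> sec g x = sec h x) \<Longrightarrow> g = h"
    and fl_closed: "(\<And>x. x \<in> carrier R \<Longrightarrow> k x \<in> carrier A) \<Longrightarrow> fl k \<in> carrier A"
    and act_fl: "(\<And>x. x \<in> carrier R \<Longrightarrow> k x \<in> carrier A) \<Longrightarrow> y \<in> carrier R \<Longrightarrow> act (fl k) y = y"
    and sec_fl: "(\<And>x. x \<in> carrier R \<Longrightarrow> k x \<in> carrier A) \<Longrightarrow> y \<in> carrier R \<Longrightarrow> sec (fl k) y = k y"
    and rt_closed [simp]: "r \<in> carrier R \<Longrightarrow> rt r \<in> carrier A"
    and act_rt [simp]: "r \<in> carrier R \<Longrightarrow> x \<in> carrier R \<Longrightarrow> act (rt r) x = r \<otimes>\<^bsub>R\<^esub> x"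
    and sec_rt [simp]: "r \<in> carrier R \<Longrightarrow> x \<in> carrier R \<Longrightarrow> sec (rt r) x = \<one>"
begin

abbreviation "X \<equiv> carrier R"
abbreviation "e \<equiv> \<one>\<^bsub>R\<^esub>"
abbreviation "RG \<equiv> rt ` carrier R"

lemma sec_one [simp]: "x \<in> X \<Longrightarrow> sec \<one> x = \<one>"
  using sec_mult[of \<one> \<one> x] r_cancel_one[of "sec \<one> x" "sec \<one> x"] by simp

lemma act_inv_act [simp]: "g \<in> carrier A \<Longrightarrow> x \<in> X \<Longrightarrow> act (inv g) (act g x) = x"
  using act_mult[of "inv g" g x] by simp

lemma act_act_inv [simp]: "g \<in> carrier A \<Longrightarrow> x \<in> X \<Longrightarrow> act g (act (inv g) x) = x"
  using act_mult[of g "inv g" x] by simp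

lemma sec_inv_act [simp]:
  assumes "g \<in> carrier A" "x \<in> X" shows "sec (inv g) (act g x) = inv (sec g x)"
proof -
  have "sec (inv g) (act g x) \<otimes> sec g x = \<one>"
    using sec_mult[of "inv g" g x] assms by simp
  then show ?thesis using assms by (intro inv_equality[symmetric]) auto
qed

lemma sec_inv: "g \<in> carrier A \<Longrightarrow> x \<in> X \<Longrightarrow> sec (inv g) x = inv (sec g (act (inv g) x))"
  using sec_inv_act[of g "act (inv g) x"] by simp

lemma act_inv_fix: "g \<in> carrier A \<Longrightarrow> x \<in> X \<Longrightarrow> act g x = x \<Longrightarrow> act (inv g) x = x"
  using act_inv_act[of g x] by simp

lemma bij_act: "g \<in> carrier A \<Longrightarrow> bij_betw (act g) X X"
  by (rule bij_betwI[where g = "act (inv g)"]) auto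

lemma sec_conj:
  assumes "c \<in> carrier A" "h \<in> carrier A" "x \<in> X" "act h x = x"
  shows "act (c \<otimes> h \<otimes> inv c) (act c x) = act c x"
    and "sec (c \<otimes> h \<otimes> inv c) (act c x) = sec c x \<otimes> sec h x \<otimes> inv (sec c x)"
  using assms by simp_all

lemma sec_pow:
  assumes "h \<in> carrier A" "x \<in> X" "act h x = x"
  shows "act (h [^] (n::nat)) x = x \<and> sec (h [^] n) x = sec h x [^] n"
  using assms by (induction n) auto

lemma rt_mult: "r \<in> X \<Longrightarrow> s \<in> X \<Longrightarrow> rt (r \<otimes>\<^bsub>R\<^esub> s) = rt r \<otimes> rt s"
  by (rule wreath_eqI) (auto simp: R.m_assoc)

lemma rt_one: "rt e = \<one>"
  by (rule wreath_eqI) auto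

lemma rt_inj: "r \<in> X \<Longrightarrow> s \<in> X \<Longrightarrow> rt r = rt s \<Longrightarrow> r = s"
  by (metis act_rt R.one_closed R.r_one)

lemma subgroup_RG: "subgroup RG A"
proof -
  interpret rt: group_hom R A rt
    by unfold_locales (auto simp: hom_def rt_mult)
  show ?thesis by (rule rt.img_is_subgroup)
qed

lemma inv_rt: "r \<in> X \<Longrightarrow> inv (rt r) = rt (inv\<^bsub>R\<^esub> r)"
  by (rule inv_equality) (auto simp: rt_mult[symmetric] rt_one)

lemma act_inv_rt [simp]: "r \<in> X \<Longrightarrow> x \<in> X \<Longrightarrow> act (inv (rt r)) x = inv\<^bsub>R\<^esub> r \<otimes>\<^bsub>R\<^esub> x"
  by (simp add: inv_rt)

lemma sec_inv_rt [simp]: "r \<in> X \<Longrightarrow> x \<in> X \<Longrightarrow> sec (inv (rt r)) x = \<one>"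
  by (simp add: inv_rt)

definition single :: "'a \<Rightarrow> 'g \<Rightarrow> 'g" where
  "single x k = fl (\<lambda>y. if y = x then k else \<one>)"

lemma single_closed [simp]: "k \<in> carrier A \<Longrightarrow> single x k \<in> carrier A"
  unfolding single_def by (rule fl_closed) auto

lemma act_single [simp]: "k \<in> carrier A \<Longrightarrow> y \<in> X \<Longrightarrow> act (single x k) y = y"
  unfolding single_def by (rule act_fl) auto

lemma sec_single [simp]:
  "k \<in> carrier A \<Longrightarrow> y \<in> X \<Longrightarrow> sec (single x k) y = (if y = x then k else \<one>)"
  unfolding single_def by (subst sec_fl) auto

lemma conj_single:
  assumes "c \<in> carrier A" "k \<in> carrier A" "x \<in> X"
  shows "c \<otimes> single x k \<otimes> inv c = single (act c x) (sec c x \<otimes> k \<otimes> inv (sec c x))"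
proof (rule wreath_eqI)
  fix y assume y: "y \<in> X"
  show "sec (c \<otimes> single x k \<otimes> inv c) y
      = sec (single (act c x) (sec c x \<otimes> k \<otimes> inv (sec c x))) y"
  proof (cases "y = act c x")
    case True
    then show ?thesis using assms sec_conj(2)[of c "single x k" x] by simp
  next
    case False
    then have "act (inv c) y \<noteq> x" using assms y by auto
    then show ?thesis using False assms y by (simp add: sec_inv)
  qed
qed (use assms in simp_all)

text \<open>
  An element with sections in \<open>L\<close> is the product of its finitely many coordinates; peeling them off
  one at a time avoids choosing an order of the factors.
\<close>

lemma mem_of_singles:
  assumes M: "subgroup M A" and L: "\<one> \<in> L" "L \<subseteq> carrier A"
    and single: "\<And>x l. x \<in> X \<Longrightarrow> l \<in> L \<Longrightarrow> single x l \<in> M"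
    and f: "f \<in> carrier A" "\<And>x. x \<in> X \<Longrightarrow> act f x = x" "\<And>x. x \<in> X \<Longrightarrow> sec f x \<in> L"
  shows "f \<in> M"
proof -
  interpret M: subgroup M A by (rule M)
  have "f \<in> M" if "finite Y" "Y \<subseteq> X" "f \<in> carrier A" "\<And>x. x \<in> X \<Longrightarrow> act f x = x"
    "\<And>x. x \<in> X \<Longrightarrow> sec f x \<in> L" "\<And>x. x \<in> X - Y \<Longrightarrow> sec f x = \<one>" for Y f
    using that
  proof (induction arbitrary: f)
    case empty
    have "f = \<one>"
    proof (rule wreath_eqI)
      show "sec f x = sec \<one> x" if "x \<in> X" for x
        using empty.prems(5)[of x] that by simp
    qed (use empty.prems in simp_all)
    then show ?case by simp
  next
    case (insert y Y)
    let ?s = "single y (sec f y)"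
    have y: "y \<in> X" and f: "f \<in> carrier A" using insert.prems(1,2) by simp_all
    then have s: "?s \<in> M" by (intro single insert.prems(4))
    have sA: "?s \<in> carrier A" using s by simp
    have inv_act: "act (inv ?s) x = x" if "x \<in> X" for x
      using act_inv_fix[OF sA that] that f y by simp
    have act: "act (inv ?s \<otimes> f) x = x" if "x \<in> X" for x
      using that f sA inv_act[OF that] insert.prems(3)[OF that] by simp
    have sec: "sec (inv ?s \<otimes> f) x = (if x = y then \<one> else sec f x)" if "x \<in> X" for x
      using that f y sA inv_act[OF that] insert.prems(3)[OF that] by (simp add: sec_inv)
    have "inv ?s \<otimes> f \<in> M"
    proof (rule insert.IH)
      show "sec (inv ?s \<otimes> f) x \<in> L" if "x \<in> X" for x
        unfolding sec[OF that] using insert.prems(4)[OF that] L(1) by simp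
      show "sec (inv ?s \<otimes> f) x = \<one>" if "x \<in> X - Y" for x
        using sec[of x] insert.prems(5)[of x] that by auto
    qed (use insert.prems(1) sA f act in auto)
    then have "?s \<otimes> (inv ?s \<otimes> f) \<in> M" using s by (rule M.m_closed[rotated])
    then show ?case using sA f by (simp add: m_assoc[symmetric])
  qed
  then show ?thesis using f finite_X by blast
qed

text \<open>
  The elements all of whose sections on layer \<open>n\<close> lie in \<open>U\<close>.
\<close>

primrec level :: "nat \<Rightarrow> 'g set \<Rightarrow> 'g set" where
  "level 0 U = U"
| "level (Suc n) U = {g \<in> carrier A. \<forall>x \<in> X. sec g x \<in> level n U}"

lemma level_closed: "U \<subseteq> carrier A \<Longrightarrow> level n U \<subseteq> carrier A"
  by (cases n) auto

lemma level_mono: "U \<subseteq> V \<Longrightarrow> level n U \<subseteq> level n V"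
  by (induction n) auto

lemma level_level: "level m (level n U) = level (m + n) U"
  by (induction m) auto

lemma level_le:
  assumes "U \<subseteq> level 1 U" "m \<le> n" shows "level m U \<subseteq> level n U"
proof -
  have "level n U \<subseteq> level (Suc n) U" for n
    using level_mono[OF assms(1), of n] unfolding level_level by (simp only: Suc_eq_plus1)
  then show ?thesis using assms(2) by (rule lift_Suc_mono_le)
qed

lemma level_mult:
  assumes "U \<subseteq> carrier A" "V \<subseteq> carrier A"
  shows "g \<in> level n U \<Longrightarrow> h \<in> level n V \<Longrightarrow> g \<otimes> h \<in> level n (U <#> V)"
proof (induction n arbitrary: g h)
  case 0
  then show ?case by (auto simp: set_mult_def)
next
  case (Suc n)
  then have gh: "g \<in> carrier A" "h \<in> carrier A" by simp_all
  moreover have "sec (g \<otimes> h) x \<in> level n (U <#> V)" if "x \<in> X" for x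
    unfolding sec_mult[OF gh that] using Suc.prems gh that by (intro Suc.IH) simp_all
  ultimately show ?case by simp
qed

lemma level_inv:
  assumes "U \<subseteq> carrier A" "\<And>u. u \<in> U \<Longrightarrow> inv u \<in> U"
  shows "g \<in> level n U \<Longrightarrow> inv g \<in> level n U"
proof (induction n arbitrary: g)
  case 0
  then show ?case unfolding level.simps by (rule assms(2))
next
  case (Suc n)
  then show ?case by (auto simp: sec_inv)
qed

lemma subgroup_sections:
  assumes M: "subgroup M A" and x: "x \<in> X"
  shows "subgroup ((\<lambda>m. sec m x) ` {m \<in> M. act m x = x}) A" (is "subgroup ?S A")
proof -
  interpret M: subgroup M A by (rule M)
  show ?thesis
  proof (rule subgroupI)
    show "?S \<subseteq> carrier A" using x by auto
    show "?S \<noteq> {}" using x M.one_closed act_one by blast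
    show "inv a \<in> ?S" if "a \<in> ?S" for a
    proof -
      from that obtain m where m: "m \<in> M" "act m x = x" "a = sec m x" by auto
      then have "inv a = sec (inv m) x" "act (inv m) x = x"
        using x sec_inv_act[of m x] act_inv_fix[of m x] by auto
      then show ?thesis using m by blast
    qed
    show "a \<otimes> b \<in> ?S" if "a \<in> ?S" "b \<in> ?S" for a b
    proof -
      from that obtain m k where "m \<in> M" "act m x = x" "a = sec m x"
        "k \<in> M" "act k x = x" "b = sec k x" by auto
      then have "a \<otimes> b = sec (m \<otimes> k) x" "act (m \<otimes> k) x = x" "m \<otimes> k \<in> M"
        using x by auto
      then show ?thesis by blast
    qed
  qed
qed

lemma subgroup_level:
  assumes M: "subgroup M A" shows "subgroup (level n M) A"
proof (rule subgroupI)
  interpret M: subgroup M A by (rule M)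
  show "level n M \<subseteq> carrier A" using M.subset by (rule level_closed)
  have "\<one> \<in> level n M" by (induction n) auto
  then show "level n M \<noteq> {}" by blast
  show "inv a \<in> level n M" if "a \<in> level n M" for a
    using M.subset M.m_inv_closed that by (rule level_inv)
  have "M <#> M \<subseteq> M" by (auto simp: set_mult_def)
  then have mono: "level n (M <#> M) \<subseteq> level n M" by (rule level_mono)
  show "a \<otimes> b \<in> level n M" if "a \<in> level n M" "b \<in> level n M" for a b
    using level_mult[OF M.subset M.subset that] mono by blast
qed

lemma single_mult: "k \<in> carrier A \<Longrightarrow> l \<in> carrier A \<Longrightarrow> single x (k \<otimes> l) = single x k \<otimes> single x l"
  by (rule wreath_eqI) auto

lemma single_one: "single x \<one> = \<one>"
  by (rule wreath_eqI) auto

lemma single_inv: "k \<in> carrier A \<Longrightarrow> single x (inv k) = inv (single x k)"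
  using single_mult[of "inv k" k x] by (intro inv_equality[symmetric]) (auto simp: single_one)

text \<open>geometric product\<close>
text \<open>
  The power of \<open>U\<close> over the first layer; being regular branch over \<open>K\<close> means that
  \<open>first_layer_stab K\<close> is contained in \<open>K\<close> with finite index.
\<close>

definition first_layer_stab :: "'g set \<Rightarrow> 'g set" where
  "first_layer_stab U = {f \<in> carrier A. \<forall>x \<in> X. act f x = x \<and> sec f x \<in> U}"

lemma first_layer_stabD:
  "f \<in> first_layer_stab U \<Longrightarrow> f \<in> carrier A"
  "f \<in> first_layer_stab U \<Longrightarrow> x \<in> X \<Longrightarrow> act f x = x"
  "f \<in> first_layer_stab U \<Longrightarrow> x \<in> X \<Longrightarrow> sec f x \<in> U"
  unfolding first_layer_stab_def by blast+

lemma first_layer_stabI: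
  "f \<in> carrier A \<Longrightarrow> (\<And>x. x \<in> X \<Longrightarrow> act f x = x) \<Longrightarrow> (\<And>x. x \<in> X \<Longrightarrow> sec f x \<in> U) \<Longrightarrow>
   f \<in> first_layer_stab U"
  unfolding first_layer_stab_def by blast

lemma single_first_layer_stab:
  "\<one> \<in> U \<Longrightarrow> U \<subseteq> carrier A \<Longrightarrow> k \<in> U \<Longrightarrow> single x k \<in> first_layer_stab U"
  by (rule first_layer_stabI) (auto simp: subset_iff)

lemma subgroup_first_layer_stab:
  assumes U: "subgroup U A" shows "subgroup (first_layer_stab U) A"
proof (rule subgroup.intro)
  interpret U: subgroup U A by (rule U)
  note D = first_layer_stabD
  show "first_layer_stab U \<subseteq> carrier A" using D(1) by blast
  show "\<one> \<in> first_layer_stab U" by (rule first_layer_stabI) simp_all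
  show "inv a \<in> first_layer_stab U" if a: "a \<in> first_layer_stab U" for a
  proof (rule first_layer_stabI)
    show "inv a \<in> carrier A" using D(1)[OF a] by simp
    fix x assume x: "x \<in> X"
    show act: "act (inv a) x = x" by (rule act_inv_fix[OF D(1)[OF a] x D(2)[OF a x]])
    show "sec (inv a) x \<in> U" using D(3)[OF a x] by (simp add: sec_inv[OF D(1)[OF a] x] act)
  qed
  show "a \<otimes> b \<in> first_layer_stab U" if a: "a \<in> first_layer_stab U" and b: "b \<in> first_layer_stab U" for a b
  proof (rule first_layer_stabI)
    show "a \<otimes> b \<in> carrier A" using D(1)[OF a] D(1)[OF b] by simp
    fix x assume x: "x \<in> X"
    show "act (a \<otimes> b) x = x" using D(1)[OF a] D(1)[OF b] D(2)[OF a x] D(2)[OF b x] x by simp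
    show "sec (a \<otimes> b) x \<in> U"
      using D(1)[OF a] D(1)[OF b] D(2)[OF b x] D(3)[OF a x] D(3)[OF b x] x by simp
  qed
qed

end

section \<open>Groups generated by rooted and directed automorphisms\<close>

text \<open>
  The last condition holds for trees since a directed automorphism is determined by its sections away
  from the identity letter; it cannot be derived from the recursion of the first layer alone.
\<close>

locale directed_group = wreath_recursion A R act sec fl rt
  for A :: "('g, 'n) monoid_scheme" (structure) and R :: "('a, 'm) monoid_scheme"
    and act sec fl rt +
  fixes D :: "'g set"
  assumes subgroup_D: "subgroup D A"
    and act_D [simp]: "d \<in> D \<Longrightarrow> x \<in> carrier R \<Longrightarrow> act d x = x"
    and sec_D_e [simp]: "d \<in> D \<Longrightarrow> sec d \<one>\<^bsub>R\<^esub> = d"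
    and sec_D: "d \<in> D \<Longrightarrow> x \<in> carrier R \<Longrightarrow> x \<noteq> \<one>\<^bsub>R\<^esub> \<Longrightarrow> sec d x \<in> rt ` carrier R"
    and D_eq_one: "d \<in> D \<Longrightarrow> (\<And>x. x \<in> carrier R \<Longrightarrow> x \<noteq> \<one>\<^bsub>R\<^esub> \<Longrightarrow> sec d x = \<one>) \<Longrightarrow> d = \<one>"
begin

sublocale D: subgroup D A by (rule subgroup_D)
sublocale RG: subgroup RG A by (rule subgroup_RG)

text \<open>
  The nucleus of the contracting group \<open>span\<close>; \<open>deep\<close> consists of the automorphisms whose sections
  eventually belong to the nucleus.  Passing to \<open>deep\<close> is essential when two families of directed
  elements are compared, because an element generated by one may only be deep for the other.
\<close>

definition nuc :: "'g set" where "nuc = RG \<union> D"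
definition span :: "'g set" where "span = generate A nuc"
definition deep :: "'g set" where "deep = (\<Union>n. level n nuc)"

lemma RG_Int_D: "rt r \<in> D \<Longrightarrow> r \<in> X \<Longrightarrow> rt r = \<one>"
  using act_D[of "rt r" e] R.one_closed by (metis act_rt R.r_one rt_one)

lemma nuc_closed: "nuc \<subseteq> carrier A"
  by (auto simp: nuc_def)

lemma inv_nuc: "u \<in> nuc \<Longrightarrow> inv u \<in> nuc"
  unfolding nuc_def using RG.m_inv_closed D.m_inv_closed by blast

lemma one_nuc: "\<one> \<in> nuc"
  unfolding nuc_def using D.one_closed by blast

lemma sec_nuc: "u \<in> nuc \<Longrightarrow> x \<in> X \<Longrightarrow> sec u x \<in> nuc"
  using sec_D[of u x] one_nuc unfolding nuc_def by (cases "x = e") auto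

lemma nuc_level: "nuc \<subseteq> level 1 nuc"
  using sec_nuc nuc_closed by auto

text \<open>
  Contraction: one layer further down, a product of two nucleus elements is back in the nucleus.  A
  rooted factor has trivial sections, and two directed factors multiply to a directed one.
\<close>

lemma sec_nuc_mult:
  assumes u: "u \<in> nuc" and v: "v \<in> nuc" and x: "x \<in> X"
  shows "sec (u \<otimes> v) x \<in> nuc"
proof -
  have c: "u \<in> carrier A" "v \<in> carrier A" using u v nuc_closed by auto
  consider "v \<in> RG" | "u \<in> RG" | "u \<in> D" "v \<in> D" using u v by (auto simp: nuc_def)
  then show ?thesis
  proof cases
    case 1
    then have "sec (u \<otimes> v) x = sec u (act v x)" using c x by auto
    then show ?thesis using sec_nuc[OF u] c x by simp
  next
    case 2
    then have "sec (u \<otimes> v) x = sec v x" using c x by auto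
    then show ?thesis using sec_nuc[OF v x] by simp
  next
    case 3
    then show ?thesis by (intro sec_nuc x) (simp add: nuc_def)
  qed
qed

lemma nuc_mult_level: "nuc <#> nuc \<subseteq> level 1 nuc"
  using sec_nuc_mult nuc_closed by (auto simp: set_mult_def subset_iff)

lemma level_nuc_le: "m \<le> n \<Longrightarrow> level m nuc \<subseteq> level n nuc"
  by (rule level_le[OF nuc_level])

lemma level_nuc_mult:
  assumes "g \<in> level n nuc" "h \<in> level n nuc" shows "g \<otimes> h \<in> level (Suc n) nuc"
  using level_mult[OF nuc_closed nuc_closed assms] level_mono[OF nuc_mult_level, of n]
  unfolding level_level by (auto simp only: Suc_eq_plus1)

lemma deepE2:
  assumes "g \<in> deep" "h \<in> deep"
  obtains n where "g \<in> level n nuc" "h \<in> level n nuc"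
proof -
  obtain m n where "g \<in> level m nuc" "h \<in> level n nuc" using assms by (auto simp: deep_def)
  then show ?thesis
    using level_nuc_le[of m "max m n"] level_nuc_le[of n "max m n"] that[of "max m n"] by auto
qed

lemma subgroup_deep: "subgroup deep A"
proof (rule subgroupI)
  show "deep \<subseteq> carrier A" using level_closed[OF nuc_closed] by (auto simp: deep_def)
  have "\<one> \<in> level 0 nuc" using one_nuc by simp
  then show "deep \<noteq> {}" unfolding deep_def by blast
  show "inv a \<in> deep" if "a \<in> deep" for a
    using that level_inv[OF nuc_closed inv_nuc] unfolding deep_def by blast
  show "a \<otimes> b \<in> deep" if ab: "a \<in> deep" "b \<in> deep" for a b
  proof -
    obtain n where "a \<in> level n nuc" "b \<in> level n nuc" by (rule deepE2[OF ab])
    then have "a \<otimes> b \<in> level (Suc n) nuc" by (rule level_nuc_mult)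
    then show ?thesis unfolding deep_def by blast
  qed
qed

lemma subgroup_span: "subgroup span A"
  unfolding span_def by (rule generate_is_subgroup[OF nuc_closed])

sublocale span: subgroup span A by (rule subgroup_span)

lemma nuc_span: "nuc \<subseteq> span"
  unfolding span_def by (auto intro: generate.incl)

lemma RG_span: "r \<in> X \<Longrightarrow> rt r \<in> span" and D_span: "D \<subseteq> span"
  using nuc_span by (auto simp: nuc_def)

lemma span_least: "subgroup M A \<Longrightarrow> (\<And>r. r \<in> X \<Longrightarrow> rt r \<in> M) \<Longrightarrow> D \<subseteq> M \<Longrightarrow> span \<subseteq> M"
  unfolding span_def nuc_def by (rule generate_subgroup_incl) auto

lemma nuc_deep: "nuc \<subseteq> deep"
proof -
  have "level 0 nuc \<subseteq> deep" unfolding deep_def by blast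
  then show ?thesis by simp
qed

lemma span_deep: "span \<subseteq> deep"
  unfolding span_def by (rule generate_subgroup_incl[OF nuc_deep subgroup_deep])

lemma sec_span: 
  assumes "g \<in> span" "x \<in> X" shows "sec g x \<in> span"
proof -
  have "span \<subseteq> level 1 span"
    unfolding span_def
    by (rule generate_subgroup_incl[OF _ subgroup_level])
      (use nuc_closed sec_nuc nuc_span subgroup_span in \<open>auto simp: span_def[symmetric]\<close>)
  then show ?thesis using assms by auto
qed

lemma act_span:
  assumes "g \<in> span" "x \<in> X" shows "act g x = act g e \<otimes>\<^bsub>R\<^esub> x"
proof -
  let ?M = "{g \<in> carrier A. \<forall>x \<in> X. act g x = act g e \<otimes>\<^bsub>R\<^esub> x}"
  have "subgroup ?M A"
  proof (rule subgroupI)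
    have "\<one> \<in> ?M" by simp
    then show "?M \<noteq> {}" by blast
    fix a assume a: "a \<in> ?M"
    have "act (inv a) x = act (inv a) e \<otimes>\<^bsub>R\<^esub> x" if x: "x \<in> X" for x
    proof -
      have aA: "a \<in> carrier A" and tr: "\<And>y. y \<in> X \<Longrightarrow> act a y = act a e \<otimes>\<^bsub>R\<^esub> y"
        using a by blast+
      have "act a (act (inv a) e \<otimes>\<^bsub>R\<^esub> x) = act a e \<otimes>\<^bsub>R\<^esub> act (inv a) e \<otimes>\<^bsub>R\<^esub> x"
        using aA x by (subst tr) (simp_all add: R.m_assoc)
      also have "act a e \<otimes>\<^bsub>R\<^esub> act (inv a) e = act a (act (inv a) e)"
        using aA by (subst (2) tr) simp_all
      finally have "act a (act (inv a) e \<otimes>\<^bsub>R\<^esub> x) = x" using aA x by simp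
      then have "act (inv a) (act a (act (inv a) e \<otimes>\<^bsub>R\<^esub> x)) = act (inv a) x" by simp
      then show ?thesis using aA x by simp
    qed
    then show "inv a \<in> ?M" using a inv_closed by blast
    fix b assume b: "b \<in> ?M"
    have "act (a \<otimes> b) x = act (a \<otimes> b) e \<otimes>\<^bsub>R\<^esub> x" if x: "x \<in> X" for x
    proof -
      have A: "a \<in> carrier A" "b \<in> carrier A" using a b by blast+
      have tr: "\<And>y. y \<in> X \<Longrightarrow> act a y = act a e \<otimes>\<^bsub>R\<^esub> y" "act b x = act b e \<otimes>\<^bsub>R\<^esub> x"
        using a b x by blast+
      have "act (a \<otimes> b) x = act a e \<otimes>\<^bsub>R\<^esub> (act b e \<otimes>\<^bsub>R\<^esub> x)"
        using A x tr(1)[of "act b x"] by (simp add: tr(2)[symmetric])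
      moreover have "act (a \<otimes> b) e = act a e \<otimes>\<^bsub>R\<^esub> act b e"
        using A tr(1)[of "act b e"] by simp
      ultimately show ?thesis using A x by (metis R.m_assoc R.one_closed act_closed)
    qed
    then show "a \<otimes> b \<in> ?M" using a b m_closed by blast
  qed auto
  then have "span \<subseteq> ?M" by (rule span_least) auto
  then show ?thesis using assms by blast
qed

text \<open>
  The permutation of the first layer induced by an element of \<open>span\<close> is a left translation, so it is
  recorded by the image of the identity letter.
\<close>

lemma top_hom:
  assumes B: "comm_group B" and al: "\<alpha> \<in> hom (A\<lparr>carrier := RG\<rparr>) B"
  obtains \<chi> where "\<chi> \<in> hom (A\<lparr>carrier := span\<rparr>) B" "\<And>r. r \<in> X \<Longrightarrow> \<chi> (rt r) = \<alpha> (rt r)"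
    "\<And>d. d \<in> D \<Longrightarrow> \<chi> d = \<one>\<^bsub>B\<^esub>"
proof
  let ?\<chi> = "\<lambda>g. \<alpha> (rt (act g e))"
  interpret \<alpha>: group_hom "A\<lparr>carrier := RG\<rparr>" B \<alpha>
    using al B by (intro group_hom.intro group_hom_axioms.intro subgroup_imp_group subgroup_RG)
      (auto simp: comm_group_def)
  show "?\<chi> \<in> hom (A\<lparr>carrier := span\<rparr>) B"
  proof (rule homI)
    show "?\<chi> g \<in> carrier B" if "g \<in> carrier (A\<lparr>carrier := span\<rparr>)" for g
      using that by (intro \<alpha>.hom_closed) simp
    show "?\<chi> (g \<otimes>\<^bsub>A\<lparr>carrier := span\<rparr>\<^esub> h) = ?\<chi> g \<otimes>\<^bsub>B\<^esub> ?\<chi> h"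
      if "g \<in> carrier (A\<lparr>carrier := span\<rparr>)" "h \<in> carrier (A\<lparr>carrier := span\<rparr>)" for g h
    proof -
      have gh: "g \<in> span" "h \<in> span" using that by simp_all
      have "act (g \<otimes> h) e = act g e \<otimes>\<^bsub>R\<^esub> act h e"
        using gh act_span[OF gh(1), of "act h e"] by simp
      then show ?thesis using gh \<alpha>.hom_mult[of "rt (act g e)" "rt (act h e)"] by (simp add: rt_mult)
    qed
  qed
  show "?\<chi> (rt r) = \<alpha> (rt r)" if "r \<in> X" for r using that by simp
  show "?\<chi> d = \<one>\<^bsub>B\<^esub>" if "d \<in> D" for d using that \<alpha>.hom_one by (simp add: rt_one)
qed

text \<open>
  The product of the values of \<open>\<alpha>\<close> at the directed sections on layer \<open>n\<close>.
\<close>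

primrec germ :: "('b, 'k) monoid_scheme \<Rightarrow> ('g \<Rightarrow> 'b) \<Rightarrow> nat \<Rightarrow> 'g \<Rightarrow> 'b" where
  "germ B \<alpha> 0 g = (if g \<in> D then \<alpha> g else \<one>\<^bsub>B\<^esub>)"
| "germ B \<alpha> (Suc n) g = finprod B (\<lambda>x. germ B \<alpha> n (sec g x)) X"

text \<open>
  Once the sections of an element lie in the nucleus, the product of the values of \<open>\<alpha>\<close> over a layer no
  longer depends on the layer: a directed section passes itself on at the identity letter and adds only
  rooted sections, which count as trivial.  The resulting map is multiplicative because \<open>B\<close> is
  commutative, so that the permutation of the layer does not matter.
\<close>

lemma extend_to_deep:
  fixes B :: "('b, 'k) monoid_scheme"
  assumes B: "comm_group B" and al: "\<alpha> \<in> hom (A\<lparr>carrier := D\<rparr>) B"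
  obtains \<psi> where "\<psi> \<in> hom (A\<lparr>carrier := deep\<rparr>) B" "\<And>d. d \<in> D \<Longrightarrow> \<psi> d = \<alpha> d"
    "\<And>r. r \<in> X \<Longrightarrow> \<psi> (rt r) = \<one>\<^bsub>B\<^esub>"
proof -
  interpret B: comm_group B by (rule B)
  interpret \<alpha>: group_hom "A\<lparr>carrier := D\<rparr>" B \<alpha>
    using al by (intro group_hom.intro group_hom_axioms.intro subgroup_imp_group subgroup_D) 
      (rule B.group_axioms)
  let ?p = "germ B \<alpha>"
  have al_c: "\<alpha> d \<in> carrier B" if "d \<in> D" for d using that \<alpha>.hom_closed by simp
  have al_1: "\<alpha> \<one> = \<one>\<^bsub>B\<^esub>" using \<alpha>.hom_one by simp
  have closed: "?p n g \<in> carrier B" for n g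
    by (induction n arbitrary: g) (auto intro: B.finprod_closed al_c)
  have p0_RG: "?p 0 u = \<one>\<^bsub>B\<^esub>" if "u \<in> RG" for u
    using that RG_Int_D al_1 by auto
  have reindex: "finprod B (\<lambda>x. ?p n (sec g (act h x))) X = ?p (Suc n) g" if "h \<in> carrier A" for n g h
  proof -
    have b: "inj_on (act h) X" "act h ` X = X" using bij_act[OF that] by (auto simp: bij_betw_def)
    have "finprod B (\<lambda>y. ?p n (sec g y)) (act h ` X) = finprod B (\<lambda>x. ?p n (sec g (act h x))) X"
      by (rule B.finprod_reindex) (use b closed in auto)
    then show ?thesis using b by simp
  qed
  have p1: "?p (Suc 0) u = ?p 0 u" if "u \<in> nuc" for u
  proof (cases "u \<in> D")
    case True
    have "?p (Suc 0) u = finprod B (\<lambda>x. if e = x then ?p 0 (sec u x) else \<one>\<^bsub>B\<^esub>) X"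
      unfolding germ.simps(2)
      by (rule B.finprod_cong') (use closed sec_D[OF True] p0_RG in auto)
    also have "\<dots> = ?p 0 (sec u e)"
      by (rule B.finprod_singleton) (use finite_X closed in auto)
    finally show ?thesis using True by simp
  next
    case False
    then have u: "u \<in> RG" using that by (auto simp: nuc_def)
    have "?p (Suc 0) u = finprod B (\<lambda>x. \<one>\<^bsub>B\<^esub>) X"
      unfolding germ.simps(2)
      by (rule B.finprod_cong') (use u al_1 in auto)
    then show ?thesis using p0_RG[OF u] by simp
  qed
  have stable: "?p (Suc n) g = ?p n g" if "g \<in> level n nuc" for n g
    using that
  proof (induction n arbitrary: g)
    case 0
    then show ?case using p1 by simp
  next
    case (Suc n)
    have "?p (Suc (Suc n)) g = finprod B (\<lambda>x. ?p (Suc n) (sec g x)) X"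
      by (rule germ.simps(2))
    also have "\<dots> = finprod B (\<lambda>x. ?p n (sec g x)) X"
      by (rule B.finprod_cong') (use Suc closed in \<open>auto simp del: germ.simps\<close>)
    finally show ?case by simp
  qed
  have p1_mult: "?p (Suc 0) (u \<otimes> v) = ?p 0 u \<otimes>\<^bsub>B\<^esub> ?p 0 v" if u: "u \<in> nuc" and v: "v \<in> nuc" for u v
  proof -
    have c: "u \<in> carrier A" "v \<in> carrier A" using u v nuc_closed by auto
    consider "v \<in> RG" | "u \<in> RG" | "u \<in> D" "v \<in> D" using u v by (auto simp: nuc_def)
    then show ?thesis
    proof cases
      case 1
      have "?p (Suc 0) (u \<otimes> v) = finprod B (\<lambda>x. ?p 0 (sec u (act v x))) X"
        unfolding germ.simps(2)[of _ _ 0 "u \<otimes> v"]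
        by (rule B.finprod_cong') (use c 1 closed in \<open>auto simp del: germ.simps\<close>)
      also have "\<dots> = ?p 0 u" using reindex[OF c(2), of 0 u] p1[OF u] by simp
      finally show ?thesis using p0_RG[OF 1] closed[of 0 u] by simp
    next
      case 2
      have "?p (Suc 0) (u \<otimes> v) = ?p (Suc 0) v"
        unfolding germ.simps(2)[of _ _ 0]
        by (rule B.finprod_cong') (use c 2 closed in \<open>auto simp del: germ.simps\<close>)
      then show ?thesis using p1[OF v] p0_RG[OF 2] closed[of 0 v] by simp
    next
      case 3
      then have "u \<otimes> v \<in> D" by simp
      moreover have "u \<otimes> v \<in> nuc" using calculation by (simp add: nuc_def)
      ultimately show ?thesis using p1[of "u \<otimes> v"] 3 \<alpha>.hom_mult[of u v] by simp
    qed
  qed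
  have mult: "?p (Suc n) (g \<otimes> h) = ?p n g \<otimes>\<^bsub>B\<^esub> ?p n h"
    if "g \<in> level n nuc" "h \<in> level n nuc" for n g h
    using that
  proof (induction n arbitrary: g h)
    case 0
    then show ?case using p1_mult by simp
  next
    case (Suc n)
    then have c: "g \<in> carrier A" "h \<in> carrier A" by simp_all
    have "?p (Suc (Suc n)) (g \<otimes> h)
        = finprod B (\<lambda>x. ?p n (sec g (act h x)) \<otimes>\<^bsub>B\<^esub> ?p n (sec h x)) X"
      unfolding germ.simps(2)[of _ _ "Suc n"]
    proof (rule B.finprod_cong')
      fix x assume x: "x \<in> X"
      show "?p (Suc n) (sec (g \<otimes> h) x) = ?p n (sec g (act h x)) \<otimes>\<^bsub>B\<^esub> ?p n (sec h x)"
        unfolding sec_mult[OF c x] using Suc.prems c x by (intro Suc.IH) simp_all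
    qed (use closed in auto)
    also have "\<dots> = finprod B (\<lambda>x. ?p n (sec g (act h x))) X \<otimes>\<^bsub>B\<^esub> finprod B (\<lambda>x. ?p n (sec h x)) X"
      by (rule B.finprod_multf) (use closed in auto)
    also have "\<dots> = ?p (Suc n) g \<otimes>\<^bsub>B\<^esub> ?p (Suc n) h"
      unfolding reindex[OF c(2)] by simp
    finally show ?case .
  qed
  define \<psi> where "\<psi> g = ?p (LEAST n. g \<in> level n nuc) g" for g
  have eq: "\<psi> g = ?p n g" if "g \<in> level n nuc" for g n
  proof -
    have least: "g \<in> level (LEAST n. g \<in> level n nuc) nuc"
      using that by (rule LeastI)
    have "?p k g = \<psi> g" if "k \<ge> (LEAST n. g \<in> level n nuc)" for k
      using that
    proof (induction rule: dec_induct)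
      case (step k)
      have "g \<in> level k nuc" using least level_nuc_le[OF step.hyps(1)] by blast
      then show ?case using stable[of g k] step.IH by simp
    qed (simp add: \<psi>_def)
    moreover have "(LEAST n. g \<in> level n nuc) \<le> n" using that by (rule Least_le)
    ultimately show ?thesis by simp
  qed
  have "\<psi> \<in> hom (A\<lparr>carrier := deep\<rparr>) B"
  proof (rule homI)
    show "\<psi> g \<in> carrier B" for g unfolding \<psi>_def by (rule closed)
    fix g h assume "g \<in> carrier (A\<lparr>carrier := deep\<rparr>)" "h \<in> carrier (A\<lparr>carrier := deep\<rparr>)"
    then have "g \<in> deep" "h \<in> deep" by simp_all
    then obtain n where n: "g \<in> level n nuc" "h \<in> level n nuc" by (rule deepE2)
    have "\<psi> (g \<otimes> h) = ?p n g \<otimes>\<^bsub>B\<^esub> ?p n h"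
      unfolding eq[OF level_nuc_mult[OF n]] by (rule mult[OF n])
    then show "\<psi> (g \<otimes>\<^bsub>A\<lparr>carrier := deep\<rparr>\<^esub> h) = \<psi> g \<otimes>\<^bsub>B\<^esub> \<psi> h"
      using eq[OF n(1)] eq[OF n(2)] by simp
  qed
  moreover have "\<psi> d = \<alpha> d" if "d \<in> D" for d
    using eq[of d 0] that by (simp add: nuc_def)
  moreover have "\<psi> (rt r) = \<one>\<^bsub>B\<^esub>" if "r \<in> X" for r
    using eq[of "rt r" 0] p0_RG[of "rt r"] that by (simp add: nuc_def)
  ultimately show thesis by (rule that)
qed

lemma deep_fixed:
  assumes "g \<in> deep" "sec g e = g" shows "g \<in> nuc"
proof -
  obtain n where "g \<in> level n nuc" using assms(1) by (auto simp: deep_def)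
  then show ?thesis
  proof (induction n)
    case (Suc n)
    then have "sec g e \<in> level n nuc" by simp
    then show ?case using Suc.IH assms(2) by simp
  qed simp
qed

text \<open>
  An element that is its own section at the identity letter recurs on every layer, so contraction puts it
  into the nucleus.
\<close>

lemma span_directed:
  assumes g: "g \<in> span" and fix_e: "act g e = e" "sec g e = g" shows "g \<in> D"
proof -
  have "g \<in> nuc" using g span_deep fix_e(2) by (intro deep_fixed) auto
  then consider r where "r \<in> X" "g = rt r" | "g \<in> D" by (auto simp: nuc_def)
  then show ?thesis
  proof cases
    case 1
    then have "g = \<one>" using fix_e(1) by (simp add: rt_one)
    then show ?thesis by simp
  qed
qed

lemma first_layer_stab_normal:
  assumes L: "subgroup L A" and conj: "\<And>u l. u \<in> span \<Longrightarrow> l \<in> L \<Longrightarrow> u \<otimes> l \<otimes> inv u \<in> L"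
  shows "span \<inter> first_layer_stab L \<lhd> A\<lparr>carrier := span\<rparr>"
proof (rule normal_in_subgroupI[OF subgroup_span])
  show "subgroup (span \<inter> first_layer_stab L) A"
    by (rule subgroups_Inter_pair[OF subgroup_span subgroup_first_layer_stab[OF L]])
  fix u n assume u: "u \<in> span" and n: "n \<in> span \<inter> first_layer_stab L"
  have nA: "n \<in> carrier A" and fix_n: "\<And>x. x \<in> X \<Longrightarrow> act n x = x"
    and sec_n: "\<And>x. x \<in> X \<Longrightarrow> sec n x \<in> L"
    using n first_layer_stabD[of n L] by auto
  have uA: "u \<in> carrier A" using u by simp
  have "u \<otimes> n \<otimes> inv u \<in> first_layer_stab L"
  proof (rule first_layer_stabI)
    fix x assume x: "x \<in> X"
    let ?y = "act (inv u) x"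
    have y: "?y \<in> X" "act u ?y = x" using uA x by simp_all
    show "act (u \<otimes> n \<otimes> inv u) x = x" using sec_conj(1)[OF uA nA y(1) fix_n[OF y(1)]] y by simp
    show "sec (u \<otimes> n \<otimes> inv u) x \<in> L"
      using sec_conj(2)[OF uA nA y(1) fix_n[OF y(1)]] y
        conj[OF sec_span[OF u y(1)] sec_n[OF y(1)]] by simp
  qed (use uA nA in simp)
  then show "u \<otimes> n \<otimes> inv u \<in> span \<inter> first_layer_stab L" using u n by auto
qed auto

end

section \<open>A special subgroup inside a constant spinal group\<close>

text \<open>
  Facts about the smaller family \<open>T\<close> carry the qualifier \<open>H\<close>; the last condition is (Gen) for \<open>T\<close>.
\<close>

locale special_pair = directed_group A R act sec fl rt D + H: directed_group A R act sec fl rt T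
  for A :: "('g, 'n) monoid_scheme" (structure) and R :: "('a, 'm) monoid_scheme"
    and act sec fl rt D T +
  assumes T_sub_D: "T \<subseteq> D"
    and gen_T: "generate A {sec t x |t x. t \<in> T \<and> x \<in> carrier R - {\<one>\<^bsub>R\<^esub>}} = rt ` carrier R"
begin

abbreviation "H0 \<equiv> H.span"
abbreviation "Hd \<equiv> derived A H.span"
abbreviation "RGd \<equiv> derived A RG"

sublocale Hd: subgroup Hd A by (rule derived_is_subgroup[OF H.span.subset])
sublocale RGd: subgroup RGd A by (rule derived_is_subgroup[OF RG.subset])

lemma Hd_sub: "Hd \<subseteq> H0" by (rule derived_incl[OF order_refl H.subgroup_span])

lemma H0_sub: "H0 \<subseteq> span"
  using RG_span D_span T_sub_D by (intro H.span_least subgroup_span) auto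

lemma RGd_sub: "RGd \<subseteq> Hd"
  using H.RG_span by (intro mono_derived) auto

lemma RGd_RG: "RGd \<subseteq> RG" by (rule derived_incl[OF order_refl subgroup_RG])

lemma D_Int_H0: "D \<inter> H0 = T"
proof
  show "T \<subseteq> D \<inter> H0" using T_sub_D H.D_span by blast
  show "D \<inter> H0 \<subseteq> T" by (auto intro: H.span_directed)
qed

text \<open>
  The sections of \<open>t\<close> away from the identity letter can be moved there by conjugating with rooted
  elements, and (Gen) says that they generate the rooted group.
\<close>

lemma fractal:
  assumes u: "u \<in> H0" and x: "x \<in> X"
  obtains h where "h \<in> H0" "act h x = x" "sec h x = u"
proof -
  let ?P = "\<lambda>x. (\<lambda>m. sec m x) ` {m \<in> H0. act m x = x}"
  have sg: "subgroup (?P x) A" if "x \<in> X" for x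
    using that by (rule subgroup_sections[OF H.subgroup_span])
  have T: "T \<subseteq> ?P e"
  proof
    fix t assume t: "t \<in> T"
    then have "t \<in> {m \<in> H0. act m e = e}" using H.D_span by auto
    moreover have "t = sec t e" using t by simp
    ultimately show "t \<in> ?P e" by (rule rev_image_eqI)
  qed
  have "generate A {sec t x |t x. t \<in> T \<and> x \<in> X - {e}} \<subseteq> ?P e"
  proof (rule generate_subgroup_incl[OF _ sg])
    show "{sec t x |t x. t \<in> T \<and> x \<in> X - {e}} \<subseteq> ?P e"
    proof
      fix u assume "u \<in> {sec t x |t x. t \<in> T \<and> x \<in> X - {e}}"
      then obtain t y where t: "t \<in> T" and y: "y \<in> X" "y \<noteq> e" and u: "u = sec t y" by blast
      \<comment> \<open>The section of \<open>t\<close> at \<open>y\<close>, moved to the identity letter.\<close>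
      let ?m = "inv (rt y) \<otimes> t \<otimes> rt y"
      have "?m \<in> {m \<in> H0. act m e = e}" using t y H.D_span H.RG_span by auto
      moreover have "u = sec ?m e" using t y u by simp
      ultimately show "u \<in> ?P e" by (rule rev_image_eqI)
    qed
  qed simp
  then have "rt r \<in> ?P e" if "r \<in> X" for r unfolding gen_T using that by blast
  then have "H0 \<subseteq> ?P e" using T by (intro H.span_least sg) auto
  then obtain m where m: "m \<in> H0" "act m e = e" "sec m e = u" using u by blast
  let ?h = "rt x \<otimes> m \<otimes> inv (rt x)"
  have "?h \<in> H0" using m x H.RG_span by auto
  moreover have "act ?h x = x" "sec ?h x = u" using m x u by simp_all
  ultimately show ?thesis by (rule that)
qed

lemma fractal_derived:
  assumes u: "u \<in> Hd" and x: "x \<in> X"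
  obtains h where "h \<in> Hd" "act h x = x" "sec h x = u"
proof -
  let ?P = "(\<lambda>m. sec m x) ` {m \<in> Hd. act m x = x}"
  have "Hd \<subseteq> ?P"
    unfolding derived_def[of _ H0]
  proof (rule generate_subgroup_incl)
    show "subgroup ((\<lambda>m. sec m x) ` {m \<in> generate A (derived_set A H0). act m x = x}) A"
      using x Hd.subgroup_axioms unfolding derived_def by (intro subgroup_sections)
    show "derived_set A H0 \<subseteq> (\<lambda>m. sec m x) ` {m \<in> generate A (derived_set A H0). act m x = x}"
      unfolding derived_def[symmetric]
    proof
      fix u assume "u \<in> derived_set A H0"
      then obtain a b where ab: "a \<in> H0" "b \<in> H0" and u: "u = a \<otimes> b \<otimes> inv a \<otimes> inv b" by blast
      obtain m where m: "m \<in> H0" "act m x = x" "sec m x = a" using ab(1) x by (rule fractal)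
      obtain k where k: "k \<in> H0" "act k x = x" "sec k x = b" using ab(2) x by (rule fractal)
      have A: "m \<in> carrier A" "k \<in> carrier A" using m k by auto
      note inv_fix = act_inv_fix[OF A(1) x m(2)] act_inv_fix[OF A(2) x k(2)]
      let ?c = "m \<otimes> k \<otimes> inv m \<otimes> inv k"
      have "?c \<in> Hd" using m k by (intro commutator_mem_derived)
      moreover have "act ?c x = x" using A x m k inv_fix by simp
      ultimately have "?c \<in> {m \<in> Hd. act m x = x}" by simp
      moreover have "u = sec ?c x" using A x m k inv_fix u by (simp add: sec_inv)
      ultimately show "u \<in> ?P" by (rule rev_image_eqI)
    qed
  qed
  then show ?thesis using u that by blast
qed

lemma decomposition:
  assumes h: "h \<in> H0"
  obtains r t k where "r \<in> X" "t \<in> T" "k \<in> Hd" "h = rt r \<otimes> t \<otimes> k"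
proof -
  obtain B :: "'g set monoid" and q where B: "comm_group B" and q: "q \<in> hom (A\<lparr>carrier := H0\<rparr>) B"
    and ker: "\<And>s. s \<in> H0 \<Longrightarrow> q s = \<one>\<^bsub>B\<^esub> \<longleftrightarrow> s \<in> Hd"
    by (rule abelianization[OF H.subgroup_span]) blast
  interpret B: comm_group B by (rule B)
  interpret q: group_hom "A\<lparr>carrier := H0\<rparr>" B q
    using q by (intro group_hom.intro group_hom_axioms.intro subgroup_imp_group H.subgroup_span)
      (rule B.group_axioms)
  have RT: "rt r \<in> H0" "t \<in> H0" if "r \<in> X" "t \<in> T" for r t
    using that H.RG_span H.D_span by auto
  have cl: "q g \<in> carrier B" if "g \<in> H0" for g using that q.hom_closed by simp
  have mult: "q (g \<otimes> k) = q g \<otimes>\<^bsub>B\<^esub> q k" if "g \<in> H0" "k \<in> H0" for g k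
    using that q.hom_mult by simp
  have qinv: "q (inv g) = inv\<^bsub>B\<^esub> q g" if "g \<in> H0" for g
    using that q.hom_inv by (simp add: m_inv_consistent H.subgroup_span)
  define M where "M = {g \<in> H0. \<exists>r \<in> X. \<exists>t \<in> T. q g = q (rt r) \<otimes>\<^bsub>B\<^esub> q t}"
  have MI: "g \<in> M" if "g \<in> H0" "r \<in> X" "t \<in> T" "q g = q (rt r) \<otimes>\<^bsub>B\<^esub> q t" for g r t
    using that unfolding M_def by blast
  have ME: thesis if "g \<in> M" "\<And>r t. g \<in> H0 \<Longrightarrow> r \<in> X \<Longrightarrow> t \<in> T \<Longrightarrow>
      q g = q (rt r) \<otimes>\<^bsub>B\<^esub> q t \<Longrightarrow> thesis" for g thesis
    using that unfolding M_def by blast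
  have q1: "q \<one> = \<one>\<^bsub>B\<^esub>" using q.hom_one by simp
  have RG_M: "rt r \<in> M" if "r \<in> X" for r
    using that RT[OF that H.D.one_closed] q1 cl by (intro MI[of _ r \<one>]) auto
  have "subgroup M A"
  proof (rule subgroup.intro)
    show "M \<subseteq> carrier A" unfolding M_def by auto
    show "\<one> \<in> M" using RG_M[of e] by (simp add: rt_one)
    show "inv a \<in> M" if "a \<in> M" for a
    proof (rule ME[OF that])
      fix r t assume a: "a \<in> H0" "r \<in> X" "t \<in> T" "q a = q (rt r) \<otimes>\<^bsub>B\<^esub> q t"
      note rt = RT[OF a(2,3)]
      have "q (inv a) = inv\<^bsub>B\<^esub> q (rt r) \<otimes>\<^bsub>B\<^esub> inv\<^bsub>B\<^esub> q t"
        using a(1,4) rt by (simp add: qinv B.inv_mult cl)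
      also have "\<dots> = q (rt (inv\<^bsub>R\<^esub> r)) \<otimes>\<^bsub>B\<^esub> q (inv t)"
        unfolding qinv[OF rt(2), symmetric] qinv[OF rt(1), symmetric] inv_rt[OF a(2)] ..
      finally show "inv a \<in> M" using a by (intro MI[of _ "inv\<^bsub>R\<^esub> r" "inv t"]) auto
    qed
    show "a \<otimes> b \<in> M" if "a \<in> M" "b \<in> M" for a b
    proof (rule ME[OF that(1)], rule ME[OF that(2)])
      fix r t s v assume a: "a \<in> H0" "r \<in> X" "t \<in> T" "q a = q (rt r) \<otimes>\<^bsub>B\<^esub> q t"
        and b: "b \<in> H0" "s \<in> X" "v \<in> T" "q b = q (rt s) \<otimes>\<^bsub>B\<^esub> q v"
      note rt = RT[OF a(2,3)] RT[OF b(2,3)]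
      have "q (a \<otimes> b) = q (rt r) \<otimes>\<^bsub>B\<^esub> q (rt s) \<otimes>\<^bsub>B\<^esub> (q t \<otimes>\<^bsub>B\<^esub> q v)"
        using a(1,4) b(1,4) rt by (simp add: mult cl B.m_ac)
      also have "\<dots> = q (rt (r \<otimes>\<^bsub>R\<^esub> s)) \<otimes>\<^bsub>B\<^esub> q (t \<otimes> v)"
        using a(2) b(2) rt by (simp add: mult rt_mult)
      finally show "a \<otimes> b \<in> M" using a b by (intro MI[of _ "r \<otimes>\<^bsub>R\<^esub> s" "t \<otimes> v"]) auto
    qed
  qed
  moreover have "t \<in> M" if "t \<in> T" for t
    using that RT[OF R.one_closed that] q1 cl by (intro MI[of _ e t]) (auto simp: rt_one)
  ultimately have "H0 \<subseteq> M" using RG_M by (intro H.span_least) auto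
  then have "h \<in> M" using h by blast
  then obtain r t where rt: "r \<in> X" "t \<in> T" "q h = q (rt r) \<otimes>\<^bsub>B\<^esub> q t" by (rule ME)
  let ?k = "inv (rt r \<otimes> t) \<otimes> h"
  have m: "rt r \<otimes> t \<in> H0" using RT[OF rt(1,2)] by simp
  then have "q ?k = \<one>\<^bsub>B\<^esub>"
    using h rt(3) RT[OF rt(1,2)] cl by (simp add: mult qinv)
  then have "?k \<in> Hd" using ker[of ?k] m h by simp
  moreover have "h = rt r \<otimes> t \<otimes> ?k" using m h by (simp add: m_assoc[symmetric])
  ultimately show ?thesis using that rt by blast
qed

text \<open>
  How far the maps \<open>\<chi>\<close> and \<open>\<psi>\<close> detect \<open>Hd\<close>: an element of \<open>H0\<close> in both kernels lies in \<open>Hd\<close> up to a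
  factor from \<open>T\<close> that is itself in the kernel of \<open>\<psi>\<close>.
\<close>

lemma mem_derived_of_hom:
  assumes h: "h \<in> H0"
    and B: "comm_group B" and chi: "\<chi> \<in> hom (A\<lparr>carrier := H0\<rparr>) B"
    and chi_r: "\<And>r. r \<in> X \<Longrightarrow> \<chi> (rt r) = \<one>\<^bsub>B\<^esub> \<longleftrightarrow> rt r \<in> RGd"
    and chi_t: "\<And>t. t \<in> T \<Longrightarrow> \<chi> t = \<one>\<^bsub>B\<^esub>" and chi_h: "\<chi> h = \<one>\<^bsub>B\<^esub>"
    and C: "comm_group C" and psi: "\<psi> \<in> hom (A\<lparr>carrier := H0\<rparr>) C"
    and psi_r: "\<And>r. r \<in> X \<Longrightarrow> \<psi> (rt r) = \<one>\<^bsub>C\<^esub>"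
    and psi_t: "\<And>t. t \<in> T \<Longrightarrow> \<psi> t = \<one>\<^bsub>C\<^esub> \<longleftrightarrow> t \<in> S" and psi_h: "\<psi> h = \<one>\<^bsub>C\<^esub>"
  obtains t where "t \<in> T" "t \<in> S" "inv t \<otimes> h \<in> Hd"
proof -
  obtain r t k where d: "r \<in> X" "t \<in> T" "k \<in> Hd" "h = rt r \<otimes> t \<otimes> k"
    by (rule decomposition[OF h])
  have RT: "rt r \<in> H0" "t \<in> H0" "k \<in> H0" using d H.RG_span H.D_span Hd_sub by auto
  interpret B: comm_group B by (rule B)
  interpret C: comm_group C by (rule C)
  have k1: "\<chi> k = \<one>\<^bsub>B\<^esub>" "\<psi> k = \<one>\<^bsub>C\<^esub>"
    using hom_derived_one[OF H.subgroup_span order_refl B chi d(3)]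
      hom_derived_one[OF H.subgroup_span order_refl C psi d(3)] by auto
  have cl: "\<chi> (rt r) \<in> carrier B" "\<psi> t \<in> carrier C" using chi psi RT by (auto simp: hom_def)
  have "\<chi> h = \<chi> (rt r) \<otimes>\<^bsub>B\<^esub> \<chi> t \<otimes>\<^bsub>B\<^esub> \<chi> k"
    using chi RT unfolding d(4) by (simp add: hom_def)
  then have r: "rt r \<in> RGd" using chi_h chi_t[OF d(2)] k1 cl chi_r[OF d(1)] by simp
  have "\<psi> h = \<psi> (rt r) \<otimes>\<^bsub>C\<^esub> \<psi> t \<otimes>\<^bsub>C\<^esub> \<psi> k"
    using psi RT unfolding d(4) by (simp add: hom_def)
  then have t: "t \<in> S" using psi_h psi_r[OF d(1)] k1 cl psi_t[OF d(2)] by simp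
  have "inv t \<otimes> rt r \<otimes> inv (inv t) \<in> Hd"
    using r RGd_sub RT by (intro derived_conj H.subgroup_span) auto
  then have "inv t \<otimes> rt r \<otimes> t \<otimes> k \<in> Hd" using d RT by simp
  moreover have "inv t \<otimes> h = inv t \<otimes> rt r \<otimes> t \<otimes> k" unfolding d(4) using RT by (simp add: m_assoc)
  ultimately show ?thesis using that d(2) t by simp
qed

text \<open>
  Commutators of elements of \<open>T\<close> need not exhaust \<open>T \<inter> D'\<close>, so \<open>H0 \<inter> G'\<close> can be larger than \<open>Hd\<close>; the
  factor \<open>t\<close> measures the difference.
\<close>

lemma H0_Int_derived_span:
  assumes h: "h \<in> H0" "h \<in> derived A span"
  obtains t where "t \<in> T" "t \<in> derived A D" "inv t \<otimes> h \<in> Hd"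
proof -
  obtain B :: "'g set monoid" and p where B: "comm_group B" and p: "p \<in> hom (A\<lparr>carrier := RG\<rparr>) B"
    and p_ker: "\<And>s. s \<in> RG \<Longrightarrow> p s = \<one>\<^bsub>B\<^esub> \<longleftrightarrow> s \<in> RGd"
    by (rule abelianization[OF subgroup_RG]) blast
  obtain C :: "'g set monoid" and q where C: "comm_group C" and q: "q \<in> hom (A\<lparr>carrier := D\<rparr>) C"
    and q_ker: "\<And>s. s \<in> D \<Longrightarrow> q s = \<one>\<^bsub>C\<^esub> \<longleftrightarrow> s \<in> derived A D"
    by (rule abelianization[OF subgroup_D]) blast
  obtain \<chi> where chi: "\<chi> \<in> hom (A\<lparr>carrier := span\<rparr>) B" "\<And>r. r \<in> X \<Longrightarrow> \<chi> (rt r) = p (rt r)"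
    "\<And>d. d \<in> D \<Longrightarrow> \<chi> d = \<one>\<^bsub>B\<^esub>" by (rule top_hom[OF B p]) blast
  obtain \<psi> where psi: "\<psi> \<in> hom (A\<lparr>carrier := deep\<rparr>) C" "\<And>d. d \<in> D \<Longrightarrow> \<psi> d = q d"
    "\<And>r. r \<in> X \<Longrightarrow> \<psi> (rt r) = \<one>\<^bsub>C\<^esub>" by (rule extend_to_deep[OF C q]) blast
  show ?thesis
  proof (rule mem_derived_of_hom[where \<chi> = \<chi> and \<psi> = \<psi>, OF h(1) B hom_mono[OF chi(1) H0_sub] _ _ _ C _ psi(3)])
    show "\<psi> \<in> hom (A\<lparr>carrier := H0\<rparr>) C" using H0_sub span_deep by (intro hom_mono[OF psi(1)]) auto
    show "\<chi> h = \<one>\<^bsub>B\<^esub>" by (rule hom_derived_one[OF subgroup_span order_refl B chi(1) h(2)])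
    show "\<psi> h = \<one>\<^bsub>C\<^esub>" by (rule hom_derived_one[OF subgroup_deep span_deep C psi(1) h(2)])
    show "\<And>r. r \<in> X \<Longrightarrow> (\<chi> (rt r) = \<one>\<^bsub>B\<^esub>) = (rt r \<in> RGd)" using chi(2) p_ker by simp
    show "\<And>t. t \<in> T \<Longrightarrow> \<chi> t = \<one>\<^bsub>B\<^esub>" using chi(3) T_sub_D by blast
    show "\<And>t. t \<in> T \<Longrightarrow> (\<psi> t = \<one>\<^bsub>C\<^esub>) = (t \<in> derived A D)" using psi(2) q_ker T_sub_D by auto
  qed (auto intro: that)
qed

text \<open>
  Since the deep sections of \<open>c\<close> lie in \<open>H0\<close>, the abelianization map of \<open>T\<close> is defined at \<open>c\<close>, and maps
  to commutative groups do not see conjugation by \<open>c\<close>.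
\<close>

lemma conj_derived_mem:
  assumes c: "c \<in> span" "c \<in> H.deep" and k: "k \<in> Hd" and h: "c \<otimes> k \<otimes> inv c \<in> H0"
  shows "c \<otimes> k \<otimes> inv c \<in> Hd"
proof -
  obtain B :: "'g set monoid" and p where B: "comm_group B" and p: "p \<in> hom (A\<lparr>carrier := RG\<rparr>) B"
    and p_ker: "\<And>s. s \<in> RG \<Longrightarrow> p s = \<one>\<^bsub>B\<^esub> \<longleftrightarrow> s \<in> RGd"
    by (rule abelianization[OF subgroup_RG]) blast
  obtain C :: "'g set monoid" and q where C: "comm_group C" and q: "q \<in> hom (A\<lparr>carrier := T\<rparr>) C"
    and q_ker: "\<And>s. s \<in> T \<Longrightarrow> q s = \<one>\<^bsub>C\<^esub> \<longleftrightarrow> s \<in> derived A T"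
    by (rule abelianization[OF H.subgroup_D]) blast
  obtain \<chi> where chi: "\<chi> \<in> hom (A\<lparr>carrier := span\<rparr>) B" "\<And>r. r \<in> X \<Longrightarrow> \<chi> (rt r) = p (rt r)"
    "\<And>d. d \<in> D \<Longrightarrow> \<chi> d = \<one>\<^bsub>B\<^esub>" by (rule top_hom[OF B p]) blast
  obtain \<psi> where psi: "\<psi> \<in> hom (A\<lparr>carrier := H.deep\<rparr>) C" "\<And>d. d \<in> T \<Longrightarrow> \<psi> d = q d"
    "\<And>r. r \<in> X \<Longrightarrow> \<psi> (rt r) = \<one>\<^bsub>C\<^esub>" by (rule H.extend_to_deep[OF C q]) blast
  have kk: "k \<in> span" "k \<in> H.deep" using k Hd_sub H0_sub H.span_deep by auto
  show ?thesis
  proof (rule mem_derived_of_hom[OF h B hom_mono[OF chi(1) H0_sub] _ _ _ C hom_mono[OF psi(1) H.span_deep] psi(3)])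
    show "\<chi> (c \<otimes> k \<otimes> inv c) = \<one>\<^bsub>B\<^esub>"
      using hom_derived_one[OF subgroup_span H0_sub B chi(1) k] 
      by (simp add: hom_conj[OF subgroup_span B chi(1) c(1) kk(1)])
    show "\<psi> (c \<otimes> k \<otimes> inv c) = \<one>\<^bsub>C\<^esub>"
      using hom_derived_one[OF H.subgroup_deep H.span_deep C psi(1) k] 
      by (simp add: hom_conj[OF H.subgroup_deep C psi(1) c(2) kk(2)])
    show "\<And>r. r \<in> X \<Longrightarrow> (\<chi> (rt r) = \<one>\<^bsub>B\<^esub>) = (rt r \<in> RGd)" using chi(2) p_ker by simp
    show "\<And>t. t \<in> T \<Longrightarrow> \<chi> t = \<one>\<^bsub>B\<^esub>" using chi(3) T_sub_D by blast
    show "\<And>t. t \<in> T \<Longrightarrow> (\<psi> t = \<one>\<^bsub>C\<^esub>) = (t \<in> derived A T)" using psi(2) q_ker by auto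
  next
    fix t assume t: "t \<in> T" "t \<in> derived A T" "inv t \<otimes> (c \<otimes> k \<otimes> inv c) \<in> Hd"
    have "t \<in> Hd" using t(2) mono_derived[OF H.D_span] by blast
    then have "t \<otimes> (inv t \<otimes> (c \<otimes> k \<otimes> inv c)) \<in> Hd" using t(3) by (rule Hd.m_closed)
    then show ?thesis using t(1) h by (simp add: m_assoc[symmetric])
  qed
qed

lemma sec_derived_D:
  assumes d: "d \<in> derived A D" and x: "x \<in> X" "x \<noteq> e"
  shows "sec d x \<in> RGd"
proof -
  let ?M = "{g \<in> D. \<forall>x \<in> X - {e}. sec g x \<in> RGd}"
  have inv: "sec (inv a) x = inv (sec a x)" if "a \<in> D" "x \<in> X" for a x
    using that act_inv_fix[of a x] by (simp add: sec_inv)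
  have "subgroup ?M A"
  proof (rule subgroup.intro)
    show "\<one> \<in> ?M" by simp
    show "inv a \<in> ?M" if "a \<in> ?M" for a using that by (auto simp: inv)
    show "a \<otimes> b \<in> ?M" if "a \<in> ?M" "b \<in> ?M" for a b using that by auto
  qed auto
  moreover have "derived_set A D \<subseteq> ?M"
  proof
    fix u assume "u \<in> derived_set A D"
    then obtain a b where ab: "a \<in> D" "b \<in> D" and u: "u = a \<otimes> b \<otimes> inv a \<otimes> inv b" by blast
    have "sec (a \<otimes> b \<otimes> inv a \<otimes> inv b) x \<in> RGd" if "x \<in> X - {e}" for x
    proof -
      have "sec (a \<otimes> b \<otimes> inv a \<otimes> inv b) x = sec a x \<otimes> sec b x \<otimes> inv (sec a x) \<otimes> inv (sec b x)"
        using ab that by (simp add: inv)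
      also have "\<dots> \<in> RGd" using ab that sec_D by (intro commutator_mem_derived) auto
      finally show ?thesis .
    qed
    moreover have "a \<otimes> b \<otimes> inv a \<otimes> inv b \<in> D" using ab by auto
    ultimately show "u \<in> ?M" using u by simp
  qed
  ultimately have "derived A D \<subseteq> ?M" unfolding derived_def[of _ D] by (intro generate_subgroup_incl)
  then show ?thesis using d x by blast
qed

text \<open>
  A subgroup \<open>S\<close> between \<open>T\<close> and \<open>D\<close> is recovered from the group generated by \<open>S\<close> and the rooted elements as
  its set of directed elements.
\<close>

lemma T_maximal:
  assumes max: "\<And>M. subgroup M A \<Longrightarrow> H0 \<subseteq> M \<Longrightarrow> M \<subseteq> span \<Longrightarrow> M = H0 \<or> M = span"
    and S: "subgroup S A" "T \<subseteq> S" "S \<subseteq> D"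
  shows "S = T \<or> S = D"
proof -
  interpret S: directed_group A R act sec fl rt S
  proof (rule directed_group.intro[OF wreath_recursion_axioms], rule directed_group_axioms.intro)
    show "subgroup S A" by (rule S(1))
    fix d assume "d \<in> S"
    then have d: "d \<in> D" using S(3) by blast
    show "act d x = x" if "x \<in> X" for x using d that by (rule act_D)
    show "sec d e = d" using d by (rule sec_D_e)
    show "sec d x \<in> RG" if "x \<in> X" "x \<noteq> e" for x using d that by (rule sec_D)
    show "d = \<one>" if "\<And>x. x \<in> X \<Longrightarrow> x \<noteq> e \<Longrightarrow> sec d x = \<one>" using d that by (rule D_eq_one)
  qed
  have "H0 \<subseteq> S.span" using S.RG_span S.D_span S(2) by (intro H.span_least S.subgroup_span) blast+
  moreover have "S.span \<subseteq> span" using RG_span D_span S(3) by (intro S.span_least subgroup_span) blast+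
  ultimately have "S.span = H0 \<or> S.span = span" by (intro max S.subgroup_span)
  then show ?thesis
  proof
    assume eq: "S.span = H0"
    have "S \<subseteq> D \<inter> H0" using S.D_span S(3) unfolding eq by blast
    then show ?thesis using D_Int_H0 S(2) by blast
  next
    assume eq: "S.span = span"
    have "D \<subseteq> S"
    proof
      fix d assume d: "d \<in> D"
      then have "d \<in> S.span" using D_span unfolding eq by blast
      then show "d \<in> S" by (rule S.span_directed) (use d in auto)
    qed
    then show ?thesis using S(3) by blast
  qed
qed

end

section \<open>Consequences of prodensity\<close>

locale dense_pair = special_pair A R act sec fl rt D T
  for A :: "('g, 'n) monoid_scheme" (structure) and R :: "('a, 'm) monoid_scheme"
    and act sec fl rt D T +
  assumes dense: "N \<lhd> A\<lparr>carrier := span\<rparr> \<Longrightarrow> N \<noteq> {\<one>} \<Longrightarrow> a \<in> span \<Longrightarrow> \<exists>h \<in> H0. \<exists>n \<in> N. a = h \<otimes> n"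
    and T_ne: "T \<noteq> D"
begin

text \<open>
  If \<open>R\<close> were abelian, so would be \<open>D\<close>.  The identity of \<open>D\<close> would then extend to a map on \<open>G\<close> that sends
  \<open>H0\<close> to \<open>T\<close> and whose kernel contains the rooted group; prodensity would force \<open>D = T\<close>.
\<close>

lemma RGd_nontrivial: obtains r where "r \<in> X" "r \<noteq> e" "rt r \<in> RGd"
proof (rule ccontr)
  assume "\<not> thesis"
  with that have no_r: "r = e" if "r \<in> X" "rt r \<in> RGd" for r using that by blast
  have RGd1: "s = \<one>" if s: "s \<in> RGd" for s
  proof -
    obtain r where "r \<in> X" "s = rt r" using s RGd_RG by blast
    then show ?thesis using no_r[of r] s rt_one by simp
  qed
  have D1: "d = \<one>" if d: "d \<in> derived A D" for d
  proof (rule D_eq_one)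
    show "d \<in> D" using d derived_incl[OF order_refl subgroup_D] by blast
    show "sec d x = \<one>" if "x \<in> X" "x \<noteq> e" for x by (rule RGd1[OF sec_derived_D[OF d that]])
  qed
  obtain C :: "'g set monoid" and q where C: "comm_group C" and q: "q \<in> hom (A\<lparr>carrier := D\<rparr>) C"
    and q_ker: "\<And>s. s \<in> D \<Longrightarrow> q s = \<one>\<^bsub>C\<^esub> \<longleftrightarrow> s \<in> derived A D"
    by (rule abelianization[OF subgroup_D]) blast
  obtain \<psi> where psi: "\<psi> \<in> hom (A\<lparr>carrier := deep\<rparr>) C" "\<And>d. d \<in> D \<Longrightarrow> \<psi> d = q d"
    "\<And>r. r \<in> X \<Longrightarrow> \<psi> (rt r) = \<one>\<^bsub>C\<^esub>" by (rule extend_to_deep[OF C q]) blast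
  have psi': "\<psi> \<in> hom (A\<lparr>carrier := span\<rparr>) C" by (rule hom_mono[OF psi(1) span_deep])
  interpret C: comm_group C by (rule C)
  interpret \<psi>: group_hom "A\<lparr>carrier := span\<rparr>" C \<psi>
    using psi' by (intro group_hom.intro group_hom_axioms.intro subgroup_imp_group subgroup_span)
      (rule C.group_axioms)
  have cl: "\<psi> g \<in> carrier C" if "g \<in> span" for g using that \<psi>.hom_closed by simp
  have mult: "\<psi> (g \<otimes> h) = \<psi> g \<otimes>\<^bsub>C\<^esub> \<psi> h" if "g \<in> span" "h \<in> span" for g h
    using that \<psi>.hom_mult by simp
  \<comment> \<open>The kernel of \<open>\<psi>\<close> contains all rooted elements, hence is a legitimate choice for prodensity.\<close>
  let ?N = "kernel (A\<lparr>carrier := span\<rparr>) C \<psi>"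
  have N: "g \<in> ?N \<longleftrightarrow> g \<in> span \<and> \<psi> g = \<one>\<^bsub>C\<^esub>" for g by (auto simp: kernel_def)
  have "?N \<noteq> {\<one>}"
  proof
    assume N1: "?N = {\<one>}"
    have "r = e" if "r \<in> X" for r
    proof -
      have "rt r \<in> ?N" using that psi(3) RG_span by (simp add: N)
      then have "rt r = rt e" unfolding N1 rt_one by simp
      then show ?thesis using that rt_inj by blast
    qed
    then have "d = \<one>" if "d \<in> D" for d using that by (intro D_eq_one[OF that]) blast
    then have "D \<subseteq> T" using H.D.one_closed by blast
    then show False using T_sub_D T_ne by auto
  qed
  have "D \<subseteq> T"
  proof
    fix d assume d: "d \<in> D"
    obtain h n where hn: "h \<in> H0" "n \<in> ?N" "d = h \<otimes> n"
      using dense[OF \<psi>.normal_kernel \<open>?N \<noteq> {\<one>}\<close>, of d] d D_span by blast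
    obtain r t k where h: "r \<in> X" "t \<in> T" "k \<in> Hd" "h = rt r \<otimes> t \<otimes> k"
      by (rule decomposition[OF hn(1)])
    have s: "rt r \<in> span" "t \<in> span" "k \<in> span" "n \<in> span" "h \<in> span"
      using h hn N RG_span D_span T_sub_D Hd_sub H0_sub by auto
    have "\<psi> k = \<one>\<^bsub>C\<^esub>" by (rule hom_derived_one[OF subgroup_span H0_sub C psi' h(3)])
    then have "\<psi> h = \<psi> t" using h s cl psi(3) by (simp add: mult)
    then have "\<psi> d = \<psi> t" using hn s cl N by (simp add: mult)
    moreover have t: "t \<in> D" using h T_sub_D by blast
    ultimately have "q (inv t \<otimes> d) = \<one>\<^bsub>C\<^esub>"
      using d s cl psi(2)[of "inv t \<otimes> d"] \<psi>.hom_inv[of t] D_span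
      by (auto simp: mult m_inv_consistent[OF subgroup_span])
    then have "inv t \<otimes> d = \<one>" using D1 q_ker t d by simp
    moreover have "d = t \<otimes> (inv t \<otimes> d)" using t d by (simp add: m_assoc[symmetric])
    ultimately have "d = t" using t by simp
    then show "d \<in> T" using h by simp
  qed
  then show False using T_sub_D T_ne by auto
qed

text \<open>
  For directed \<open>c\<close> and a rooted element \<open>\<rho>\<close> moving the identity letter to \<open>r\<close>, the section of \<open>c \<rho> c\<inverse>\<close> at
  the identity letter is the product of the rooted element \<open>sec c r\<close> and \<open>c\<inverse>\<close>.  So \<open>c\<close> lies in \<open>H0\<close> as soon
  as \<open>c \<rho> c\<inverse>\<close> does; the general case descends along the layers, using that \<open>Hd\<close> is fractal.
\<close>

lemma level_of_conj:
  assumes "c \<in> level n nuc" "c \<in> span" "\<And>k. k \<in> Hd \<Longrightarrow> c \<otimes> k \<otimes> inv c \<in> H0"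
  shows "c \<in> level n H.nuc"
  using assms
proof (induction n arbitrary: c)
  case 0
  then consider "c \<in> RG" | "c \<in> D" by (auto simp: nuc_def)
  then show ?case
  proof cases
    case 1
    then show ?thesis by (simp add: H.nuc_def)
  next
    case 2
    obtain r where r: "r \<in> X" "r \<noteq> e" "rt r \<in> RGd" by (rule RGd_nontrivial)
    have A: "c \<in> carrier A" using 2 by simp
    have "act (inv c) e = e" using 2 A by (intro act_inv_fix) auto
    then have "sec (c \<otimes> rt r \<otimes> inv c) e = sec c r \<otimes> inv c"
      using 2 A r by (simp add: sec_inv)
    moreover have "c \<otimes> rt r \<otimes> inv c \<in> H0" using r RGd_sub 0 by blast
    ultimately have *: "sec c r \<otimes> inv c \<in> H0" using H.sec_span[of _ e] by fastforce
    have "sec c r \<in> H0" using sec_D[OF 2 r(1,2)] H.RG_span by auto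
    then have "inv (sec c r) \<otimes> (sec c r \<otimes> inv c) \<in> H0" using * by blast
    then have "inv c \<in> H0" using A r by (simp add: m_assoc[symmetric])
    then have "c \<in> H0" using A H.span.m_inv_closed by fastforce
    then show ?thesis using 2 D_Int_H0 by (auto simp: H.nuc_def)
  qed
next
  case (Suc n)
  have A: "c \<in> carrier A" using Suc.prems by simp
  have "sec c x \<in> level n H.nuc" if x: "x \<in> X" for x
  proof (rule Suc.IH)
    show "sec c x \<in> level n nuc" "sec c x \<in> span" using Suc.prems x sec_span by auto
    fix k assume "k \<in> Hd"
    then obtain h where h: "h \<in> Hd" "act h x = x" "sec h x = k" using x by (rule fractal_derived)
    have "sec (c \<otimes> h \<otimes> inv c) (act c x) \<in> H0"
      using Suc.prems(3)[OF h(1)] A x by (intro H.sec_span) auto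
    then show "sec c x \<otimes> k \<otimes> inv (sec c x) \<in> H0"
      using sec_conj(2)[of c h x] A x h by simp
  qed
  then show ?case using A by simp
qed

text \<open>
  As \<open>B\<close> contains a copy of itself at every letter, the hypothesis on \<open>c\<close> is inherited by all sections of \<open>c\<close>.
  Some deep section is rooted, hence in \<open>H0\<close>, and conjugation by it can be undone inside \<open>H0\<close>.
\<close>

lemma subset_of_conj:
  assumes B: "B \<subseteq> carrier A" and single: "\<And>y k. y \<in> X \<Longrightarrow> k \<in> B \<Longrightarrow> single y k \<in> B"
    and "c \<in> level n nuc" "c \<in> span" "\<And>k. k \<in> B \<Longrightarrow> inv c \<otimes> k \<otimes> c \<in> H0"
  shows "B \<subseteq> H0"
proof -
  have step: "inv (sec c x) \<otimes> k \<otimes> sec c x \<in> H0"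
    if "c \<in> span" "\<And>k. k \<in> B \<Longrightarrow> inv c \<otimes> k \<otimes> c \<in> H0" "k \<in> B" "x \<in> X" for c k x
  proof -
    have A: "c \<in> carrier A" "k \<in> carrier A" using that B by auto
    have "inv c \<otimes> single (act c x) k \<otimes> c \<in> H0" using that A by (intro that(2) single) auto
    then have "sec (inv c \<otimes> single (act c x) k \<otimes> c) x \<in> H0" using that by (intro H.sec_span)
    then show ?thesis using A that by simp
  qed
  have RG: "B \<subseteq> H0" if "c \<in> RG" "\<And>k. k \<in> B \<Longrightarrow> inv c \<otimes> k \<otimes> c \<in> H0" for c
  proof
    fix k assume k: "k \<in> B"
    have c: "c \<in> H0" "c \<in> carrier A" "k \<in> carrier A" using that(1) H.RG_span k B by auto
    then have "c \<otimes> (inv c \<otimes> k \<otimes> c) \<otimes> inv c \<in> H0" using that(2)[OF k] by blast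
    then show "k \<in> H0" using c by (simp add: m_assoc) (simp add: m_assoc[symmetric])
  qed
  show ?thesis
    using assms(3-5)
  proof (induction n arbitrary: c)
    case 0
    then consider "c \<in> RG" | "c \<in> D" by (auto simp: nuc_def)
    then show ?case
    proof cases
      case 1
      then show ?thesis using RG 0 by blast
    next
      case 2
      obtain r where r: "r \<in> X" "r \<noteq> e" "rt r \<in> RGd" by (rule RGd_nontrivial)
      show ?thesis
        by (rule RG[of "sec c r"]) (use sec_D[OF 2 r(1,2)] step[OF 0(2,3)] r in auto)
    qed
  next
    case (Suc n)
    show ?case
      by (rule Suc.IH[of "sec c e"]) (use Suc.prems step[OF Suc.prems(2,3)] sec_span in auto)
  qed
qed

text \<open>
  The same descent to a rooted section of \<open>c\<close> as in \<open>subset_of_conj\<close>, with membership replaced by having a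
  power in \<open>B\<close>.
\<close>

lemma powers_of_conj:
  assumes B: "B \<subseteq> carrier A"
    and pow: "\<And>k. k \<in> B \<Longrightarrow> \<exists>b \<ge> 1. k [^] (b::nat) \<in> first_layer_stab B"
    and "c \<in> level n nuc" "c \<in> span"
    and "\<And>u. u \<in> H0 \<Longrightarrow> \<exists>b \<ge> 1. (c \<otimes> u \<otimes> inv c) [^] (b::nat) \<in> B" and "u \<in> H0"
  shows "\<exists>b \<ge> 1. u [^] (b::nat) \<in> B"
proof -
  have step: "\<exists>b \<ge> 1. (sec c x \<otimes> u \<otimes> inv (sec c x)) [^] (b::nat) \<in> B"
    if c: "c \<in> span" and hyp: "\<And>u. u \<in> H0 \<Longrightarrow> \<exists>b \<ge> 1. (c \<otimes> u \<otimes> inv c) [^] (b::nat) \<in> B"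
      and u: "u \<in> H0" and x: "x \<in> X" for c u x
  proof -
    obtain h where h: "h \<in> H0" "act h x = x" "sec h x = u" using u x by (rule fractal)
    have A: "c \<in> carrier A" "h \<in> carrier A" using c h by auto
    let ?w = "c \<otimes> h \<otimes> inv c"
    obtain a :: nat where a: "a \<ge> 1" "?w [^] a \<in> B" using hyp[OF h(1)] by blast
    obtain b :: nat where b: "b \<ge> 1" "(?w [^] a) [^] b \<in> first_layer_stab B" using pow[OF a(2)] by blast
    have w: "?w \<in> carrier A" "act c x \<in> X" using A x by auto
    have "sec (?w [^] (a * b)) (act c x) \<in> B"
      using first_layer_stabD(3)[OF b(2) w(2)] w by (simp add: nat_pow_pow)
    moreover have "sec (?w [^] (a * b)) (act c x) = (sec c x \<otimes> u \<otimes> inv (sec c x)) [^] (a * b)"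
      using sec_pow[OF w sec_conj(1)[OF A x h(2)]] sec_conj(2)[OF A x h(2)] h(3) by simp
    moreover have "a * b \<ge> 1" using a b by simp
    ultimately show ?thesis by metis
  qed
  have RG: "\<exists>b \<ge> 1. u [^] (b::nat) \<in> B"
    if c: "c \<in> RG" and hyp: "\<And>u. u \<in> H0 \<Longrightarrow> \<exists>b \<ge> 1. (c \<otimes> u \<otimes> inv c) [^] (b::nat) \<in> B"
      and u: "u \<in> H0" for c u
  proof -
    have cH: "c \<in> H0" "c \<in> carrier A" "u \<in> carrier A" using c u H.RG_span by auto
    then have "inv c \<otimes> u \<otimes> c \<in> H0" using u by blast
    moreover have "c \<otimes> (inv c \<otimes> u \<otimes> c) \<otimes> inv c = u"
      using cH by (simp add: m_assoc) (simp add: m_assoc[symmetric])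
    ultimately show ?thesis using hyp[of "inv c \<otimes> u \<otimes> c"] by simp
  qed
  show ?thesis
    using assms(3-6)
  proof (induction n arbitrary: c u)
    case 0
    then consider "c \<in> RG" | "c \<in> D" by (auto simp: nuc_def)
    then show ?case
    proof cases
      case 1
      then show ?thesis by (rule RG) (use 0 in blast)+
    next
      case 2
      obtain r where r: "r \<in> X" "r \<noteq> e" "rt r \<in> RGd" by (rule RGd_nontrivial)
      show ?thesis
        by (rule RG[OF sec_D[OF 2 r(1,2)] step[OF 0(2,3) _ r(1)] 0(4)])
    qed
  next
    case (Suc n)
    show ?case
    proof (rule Suc.IH[of "sec c e"])
      show "sec c e \<in> level n nuc" "sec c e \<in> span" using Suc.prems(1,2) sec_span by auto
    qed (use Suc.prems(4) step[OF Suc.prems(2,3)] in auto)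
  qed
qed

text \<open>
  A suitable power of \<open>f\<close> fixes the first layer; its finitely many sections have powers in \<open>B\<close> by
  induction, and the product of the exponents serves all of them at once.
\<close>

lemma power_of_level:
  assumes B: "subgroup B A" "first_layer_stab B \<subseteq> B"
    and pow: "\<And>u. u \<in> H0 \<Longrightarrow> \<exists>b \<ge> 1. u [^] (b::nat) \<in> B"
    and "f \<in> level n H0" "f \<in> span"
  shows "\<exists>b \<ge> 1. f [^] (b::nat) \<in> B"
  using assms(4,5)
proof (induction n arbitrary: f)
  case 0
  then show ?case using pow by simp
next
  case (Suc n)
  note Suc_prems = Suc.prems
  have fA: "f \<in> carrier A" using Suc.prems by simp
  have act_pow: "act (f [^] i) e = act f e [^]\<^bsub>R\<^esub> i" for i :: nat
  proof (induction i)
    case (Suc i)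
    have "f [^] Suc i = f \<otimes> f [^] i" using fA by (rule nat_pow_Suc2)
    then have "act (f [^] Suc i) e = act f e \<otimes>\<^bsub>R\<^esub> act f e [^]\<^bsub>R\<^esub> i"
      using fA \<open>f \<in> span\<close> act_span[of f "act (f [^] i) e"] Suc by simp
    then show ?case by (metis R.nat_pow_Suc2 act_closed fA R.one_closed)
  qed (use fA in simp)
  define m where "m = order R"
  have m: "m \<ge> 1" using finite_X R.order_gt_0_iff_finite unfolding m_def by simp
  let ?g = "f [^] m"
  have pow_mem: "f [^] i \<in> level (Suc n) H0 \<and> f [^] i \<in> span" for i :: nat
  proof (induction i)
    case (Suc i)
    then show ?case
      using Suc_prems subgroup.m_closed[OF subgroup_level[OF H.subgroup_span]] span.m_closed
      by (simp only: nat_pow_Suc)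
  qed (use subgroup.one_closed[OF subgroup_level[OF H.subgroup_span]] span.one_closed in
       \<open>simp only: nat_pow_0\<close>)
  then have g: "?g \<in> level (Suc n) H0" "?g \<in> span" by blast+
  \<comment> \<open>The first-layer action of \<open>f\<close> is a left translation, so the order of \<open>R\<close> kills it.\<close>
  have "act f e \<in> X" using fA by (rule act_closed) simp
  then have "act f e [^]\<^bsub>R\<^esub> m = e" unfolding m_def by (rule R.pow_order_eq_1)
  then have g_e: "act ?g e = e" by (simp only: act_pow)
  have g_fix: "act ?g x = x" if "x \<in> X" for x
    using act_span[OF g(2) that] that unfolding g_e by (simp only: R.l_one)
  have "\<exists>b \<ge> 1. sec ?g x [^] (b::nat) \<in> B" if x: "x \<in> X" for x
    by (rule Suc.IH[OF _ sec_span[OF g(2) x]]) (use g(1) x in \<open>unfold level.simps, blast\<close>)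
  then obtain b :: "'a \<Rightarrow> nat" where b: "\<And>x. x \<in> X \<Longrightarrow> b x \<ge> 1 \<and> sec ?g x [^] b x \<in> B"
    by metis
  let ?b = "\<Prod>x \<in> X. b x"
  have gA: "?g \<in> carrier A" using fA by simp
  have "?g [^] ?b \<in> first_layer_stab B"
  proof (rule first_layer_stabI)
    fix x assume x: "x \<in> X"
    note pow_g = sec_pow[OF gA x g_fix[OF x], of ?b]
    show "act (?g [^] ?b) x = x" using pow_g by (rule conjunct1)
    have "sec ?g x [^] ?b \<in> B"
      by (rule pow_mem_mult[OF B(1) sec_closed[OF gA x] conjunct2[OF b[OF x]] dvd_prodI[OF finite_X x, of b]])
    then show "sec (?g [^] ?b) x \<in> B" unfolding conjunct2[OF pow_g] .
  next
    show "?g [^] ?b \<in> carrier A" using gA by (rule nat_pow_closed)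
  qed
  then have "?g [^] ?b \<in> B" using B(2) by blast
  then have "f [^] (m * ?b) \<in> B" unfolding nat_pow_pow[OF fA] .
  moreover have "?b \<ge> 1" using b by (intro prod_ge_1) blast
  then have "m * ?b \<ge> 1" using m by (simp add: Suc_le_eq)
  ultimately show ?case by blast
qed

end

section \<open>Overgroups of a prodense branch special subgroup\<close>

text \<open>
  The branch condition is imposed on the commutator subgroup \<open>Hg\<close> of the conjugate of \<open>H0\<close> by \<open>g\<close>; of the
  finite indices only the resulting existence of powers is kept.
\<close>

locale branch_pair = dense_pair A R act sec fl rt D T
  for A :: "('g, 'n) monoid_scheme" (structure) and R :: "('a, 'm) monoid_scheme"
    and act sec fl rt D T +
  fixes g and Hg :: "'g set"
  assumes g: "g \<in> span"
    and Hg: "Hg = (\<lambda>k. g \<otimes> k \<otimes> inv g) ` derived A H.span"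
    and branch: "first_layer_stab Hg \<subseteq> Hg"
    and pow_conj: "\<And>h. h \<in> H0 \<Longrightarrow> \<exists>b \<ge> 1. (g \<otimes> h \<otimes> inv g) [^] (b::nat) \<in> Hg"
    and pow_branch: "\<And>k. k \<in> Hg \<Longrightarrow> \<exists>b \<ge> 1. k [^] (b::nat) \<in> first_layer_stab Hg"
begin

lemma g_closed: "g \<in> carrier A" using g by simp

lemma conj_g_inv: "k \<in> carrier A \<Longrightarrow> inv g \<otimes> (g \<otimes> k \<otimes> inv g) \<otimes> g = k"
  using g_closed by (simp add: m_assoc) (simp add: m_assoc[symmetric])

lemma subgroup_Hg: "subgroup Hg A"
  unfolding Hg by (rule subgroup_conj[OF Hd.subgroup_axioms g_closed])

lemma Hg_closed: "Hg \<subseteq> carrier A" by (rule subgroup.subset[OF subgroup_Hg])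

text \<open>
  Branching of \<open>Hg\<close> supplies the copies at all letters that \<open>subset_of_conj\<close> needs.
\<close>

lemma Hg_sub_H0: "Hg \<subseteq> H0"
proof -
  obtain n where n: "g \<in> level n nuc" using g span_deep by (auto simp: deep_def)
  show ?thesis
  proof (rule subset_of_conj[OF Hg_closed _ n g])
    show "single y k \<in> Hg" if "k \<in> Hg" for y k
      using single_first_layer_stab[OF subgroup.one_closed[OF subgroup_Hg] Hg_closed that] branch by blast
    show "inv g \<otimes> k \<otimes> g \<in> H0" if k: "k \<in> Hg" for k
    proof -
      obtain l where l: "l \<in> Hd" "k = g \<otimes> l \<otimes> inv g" using k unfolding Hg by blast
      then have "inv g \<otimes> k \<otimes> g = l" using conj_g_inv[of l] by simp
      then show ?thesis using l Hd_sub by blast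
    qed
  qed
qed

lemma g_level: obtains n where "g \<in> level n H.nuc" "g \<in> level n nuc"
proof -
  obtain n where n: "g \<in> level n nuc" using g span_deep by (auto simp: deep_def)
  have "g \<in> level n H.nuc" using Hg_sub_H0 unfolding Hg by (intro level_of_conj[OF n g]) blast
  then show thesis using n by (rule that)
qed

lemma conj_g_Hd:
  assumes k: "k \<in> Hd" shows "g \<otimes> k \<otimes> inv g \<in> Hd"
proof -
  have "g \<in> H.deep" using g_level unfolding H.deep_def by blast
  then show ?thesis using k Hg_sub_H0 unfolding Hg by (intro conj_derived_mem[OF g]) blast+
qed

lemma power_g_Hd: obtains b :: nat where "b \<ge> 1" "g [^] b \<in> Hd"
proof -
  obtain n where n: "g \<in> level n H.nuc" "g \<in> level n nuc" by (rule g_level)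
  have "\<exists>b \<ge> 1. u [^] (b::nat) \<in> Hg" if "u \<in> H0" for u
    by (rule powers_of_conj[OF Hg_closed pow_branch n(2) g pow_conj that])
  moreover have "g \<in> level n H0" using n(1) level_mono[OF H.nuc_span] by blast
  ultimately obtain b :: nat where b: "b \<ge> 1" "g [^] b \<in> Hg"
    using power_of_level[OF subgroup_Hg branch _ _ g] by blast
  obtain k where k: "k \<in> Hd" "g [^] b = g \<otimes> k \<otimes> inv g" using b(2) unfolding Hg by blast
  have "k = inv g \<otimes> g [^] b \<otimes> g" unfolding k(2) using conj_g_inv[of k] k(1) by simp
  also have "\<dots> = inv g \<otimes> (g [^] b \<otimes> g)" using g_closed by (simp add: m_assoc)
  also have "g [^] b \<otimes> g = g \<otimes> g [^] b" using g_closed by (metis nat_pow_Suc nat_pow_Suc2)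
  also have "inv g \<otimes> (g \<otimes> g [^] b) = g [^] b" using g_closed by (simp add: m_assoc[symmetric])
  finally show thesis using b k that by simp
qed

text \<open>
  With \<open>z = g\<^sup>b\<close> in \<open>Hd\<close>, conjugation by the inverse of \<open>g\<close> is conjugation by the inverse of \<open>z\<close> followed by
  conjugation by \<open>p\<close>, the power of \<open>g\<close> with exponent \<open>b - 1\<close>; both preserve \<open>Hd\<close>.
\<close>

lemma Hg_eq_Hd: "Hg = Hd"
proof
  show "Hg \<subseteq> Hd" unfolding Hg using conj_g_Hd by blast
  obtain b :: nat where b: "b \<ge> 1" "g [^] b \<in> Hd" by (rule power_g_Hd)
  define p where "p = g [^] (b - 1)"
  define z where "z = g [^] b"
  have pA: "p \<in> carrier A" and zA: "z \<in> carrier A" using g_closed by (simp_all add: p_def z_def)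
  have z: "z \<in> Hd" using b by (simp add: z_def)
  have "z = g \<otimes> p" using b(1) g_closed nat_pow_Suc2[of g "b - 1"] by (simp add: z_def p_def)
  then have inv_g: "inv g = p \<otimes> inv z"
    using g_closed pA by (simp add: inv_mult_group m_assoc[symmetric])
  have g_eq: "g = z \<otimes> inv p" using \<open>z = g \<otimes> p\<close> g_closed pA by (simp add: m_assoc)
  have pow: "g [^] i \<otimes> k \<otimes> inv (g [^] i) \<in> Hd" if "k \<in> Hd" for k and i :: nat
  proof (induction i)
    case (Suc i)
    have "g [^] Suc i \<otimes> k \<otimes> inv (g [^] Suc i) = g \<otimes> (g [^] i \<otimes> k \<otimes> inv (g [^] i)) \<otimes> inv g"
      unfolding nat_pow_Suc2[OF g_closed] using that g_closed by (simp add: inv_mult_group m_assoc)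
    then show ?case using conj_g_Hd[OF Suc] by simp
  qed (use that in simp)
  show "Hd \<subseteq> Hg"
  proof
    fix k assume k: "k \<in> Hd"
    have "inv z \<otimes> k \<otimes> z \<in> Hd" using k z by blast
    then have "p \<otimes> (inv z \<otimes> k \<otimes> z) \<otimes> inv p \<in> Hd" unfolding p_def by (rule pow)
    moreover have "p \<otimes> (inv z \<otimes> k \<otimes> z) \<otimes> inv p = inv g \<otimes> k \<otimes> g"
      unfolding inv_g using k pA zA by (subst g_eq) (simp add: m_assoc)
    ultimately have "inv g \<otimes> k \<otimes> g \<in> Hd" by simp
    moreover have "k = g \<otimes> (inv g \<otimes> k \<otimes> g) \<otimes> inv g"
      using k g_closed by (simp add: m_assoc) (simp add: m_assoc[symmetric])
    ultimately show "k \<in> Hg" unfolding Hg by (rule rev_image_eqI)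
  qed
qed

lemma first_layer_stab_Hd: "first_layer_stab Hd \<subseteq> Hd"
  using branch unfolding Hg_eq_Hd .

lemma single_Hd: "k \<in> Hd \<Longrightarrow> single x k \<in> Hd"
  using single_first_layer_stab[OF Hd.one_closed Hd.subset] first_layer_stab_Hd by blast

text \<open>
  The set \<open>Y\<close> contains the letters whose section is not yet known to lie in \<open>Hd\<close>.  To remove \<open>y\<close> from it,
  the factor \<open>t \<in> T \<inter> D'\<close> of the section at \<open>y\<close> is cancelled by the conjugate of \<open>t\<close> that lives at \<open>y\<close>.
  Because \<open>t \<in> D'\<close>, the other sections of this conjugate are rooted commutators, so the remaining
  letters keep their state.
\<close>

lemma mem_of_derived_sections:
  assumes "finite Y"
  shows "Y \<subseteq> X \<Longrightarrow> f \<in> carrier A \<Longrightarrow> (\<And>x. x \<in> X \<Longrightarrow> act f x = x) \<Longrightarrow>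
    (\<And>x. x \<in> X \<Longrightarrow> sec f x \<in> H0 \<inter> derived A span) \<Longrightarrow>
    (\<And>x. x \<in> X \<Longrightarrow> x \<notin> Y \<Longrightarrow> sec f x \<in> Hd) \<Longrightarrow> f \<in> H0"
  using assms
proof (induction Y arbitrary: f rule: finite_induct)
  case empty
  then have "f \<in> first_layer_stab Hd" by (intro first_layer_stabI) blast+
  then show ?case using first_layer_stab_Hd Hd_sub by blast
next
  case (insert y Y)
  note f = \<open>f \<in> carrier A\<close> and f_fix = insert.prems(3) and f_sec = insert.prems(4) and f_Hd = insert.prems(5)
  have y: "y \<in> X" using insert.prems(1) by simp
  have "sec f y \<in> H0" "sec f y \<in> derived A span" using f_sec[OF y] by blast+
  then obtain t where t: "t \<in> T" "t \<in> derived A D" "inv t \<otimes> sec f y \<in> Hd"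
    by (rule H0_Int_derived_span)
  define s where "s = rt y \<otimes> t \<otimes> inv (rt y)"
  have sH: "s \<in> H0" using t y H.RG_span H.D_span unfolding s_def by auto
  have sA: "s \<in> carrier A" using sH by simp
  have s_fix: "act s x = x" if "x \<in> X" for x
    using that t y by (simp add: s_def R.m_assoc[symmetric])
  have s_inv_fix: "act (inv s) x = x" if "x \<in> X" for x
    by (rule act_inv_fix[OF sA that s_fix[OF that]])
  have s_sec: "sec s x = sec t (inv\<^bsub>R\<^esub> y \<otimes>\<^bsub>R\<^esub> x)" if "x \<in> X" for x
    using that t y by (simp add: s_def)
  have g_sec: "sec (inv s \<otimes> f) x = inv (sec t (inv\<^bsub>R\<^esub> y \<otimes>\<^bsub>R\<^esub> x)) \<otimes> sec f x" if "x \<in> X" for x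
    using that f sA f_fix[OF that] s_inv_fix[OF that] s_sec[OF that] by (simp add: sec_inv)
  have at_y: "sec (inv s \<otimes> f) y \<in> Hd" unfolding g_sec[OF y] using t y by simp
  have off_y: "inv (sec t (inv\<^bsub>R\<^esub> y \<otimes>\<^bsub>R\<^esub> x)) \<in> Hd" if "x \<in> X" "x \<noteq> y" for x
  proof -
    have "inv\<^bsub>R\<^esub> y \<otimes>\<^bsub>R\<^esub> x \<noteq> e" using that y by (metis R.inv_closed R.inv_equality R.inv_inv)
    then have "sec t (inv\<^bsub>R\<^esub> y \<otimes>\<^bsub>R\<^esub> x) \<in> RGd" using that y by (intro sec_derived_D[OF t(2)]) auto
    then show ?thesis using RGd_sub by blast
  qed
  have Hd_der: "Hd \<subseteq> H0 \<inter> derived A span" using mono_derived[OF H0_sub] Hd_sub by blast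
  interpret DS: subgroup "derived A span" A by (rule derived_is_subgroup[OF span.subset])
  have "inv s \<otimes> f \<in> H0"
  proof (rule insert.IH)
    show "Y \<subseteq> X" using insert.prems(1) by simp
    show "inv s \<otimes> f \<in> carrier A" using sA f by simp
    fix x assume x: "x \<in> X"
    show "act (inv s \<otimes> f) x = x" using sA f f_fix[OF x] s_inv_fix[OF x] x by simp
    show "sec (inv s \<otimes> f) x \<in> H0 \<inter> derived A span"
    proof (cases "x = y")
      case True
      then show ?thesis using at_y Hd_der by blast
    next
      case False
      then have "inv (sec t (inv\<^bsub>R\<^esub> y \<otimes>\<^bsub>R\<^esub> x)) \<in> H0 \<inter> derived A span" using off_y x Hd_der by blast
      then show ?thesis unfolding g_sec[OF x] using f_sec[OF x] by simp
    qed
    show "sec (inv s \<otimes> f) x \<in> Hd" if "x \<notin> Y"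
    proof (cases "x = y")
      case False
      then have "sec f x \<in> Hd" using f_Hd[OF x] that by simp
      then show ?thesis unfolding g_sec[OF x] using off_y[OF x False] by simp
    qed (use at_y in simp)
  qed
  then have "s \<otimes> (inv s \<otimes> f) \<in> H0" using sH by blast
  then show ?case using sA f by (simp add: m_assoc[symmetric])
qed

lemma derived_span_conj: "u \<in> span \<Longrightarrow> l \<in> derived A span \<Longrightarrow> u \<otimes> l \<otimes> inv u \<in> derived A span"
  by (intro derived_conj subgroup_span)

text \<open>
  Prodensity is applied to the elements of \<open>G\<close> that fix the first layer and have sections in \<open>G'\<close>; modulo \<open>H0\<close> this
  puts the sections of \<open>m\<close> into \<open>H0 \<inter> G'\<close>.
\<close>

lemma mem_of_sections:
  assumes m: "m \<in> span" and sec_m: "\<And>x. x \<in> X \<Longrightarrow> sec m x \<in> H0"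
  shows "m \<in> H0"
proof -
  let ?N = "span \<inter> first_layer_stab (derived A span)"
  have N: "?N \<lhd> A\<lparr>carrier := span\<rparr>"
    using derived_span_conj by (intro first_layer_stab_normal derived_is_subgroup span.subset)
  obtain r where r: "r \<in> X" "r \<noteq> e" "rt r \<in> RGd" by (rule RGd_nontrivial)
  have rHd: "rt r \<in> Hd" using r RGd_sub by blast
  have Hd_der: "Hd \<subseteq> derived A span" by (rule mono_derived[OF H0_sub])
  have "single e (rt r) \<in> ?N"
    using single_Hd[OF rHd] Hd_sub H0_sub rHd Hd_der
      single_first_layer_stab[of "derived A span" "rt r" e] 
      derived_is_subgroup[OF span.subset]
    by (auto simp: subgroup.one_closed subgroup.subset)
  moreover have "single e (rt r) \<noteq> \<one>"
  proof
    assume "single e (rt r) = \<one>"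
    then have "sec (single e (rt r)) e = sec \<one> e" by simp
    then have "rt r = rt e" using r rt_one by simp
    then show False using r rt_inj by blast
  qed
  ultimately have "?N \<noteq> {\<one>}" by blast
  then obtain h n where hn: "h \<in> H0" "n \<in> ?N" "m = h \<otimes> n" using dense[OF N _ m] by blast
  have A: "h \<in> carrier A" "n \<in> carrier A" "m \<in> carrier A" using hn m by auto
  have n: "n = inv h \<otimes> m" using A hn(3) by (simp add: m_assoc[symmetric])
  have "n \<in> H0"
  proof (rule mem_of_derived_sections[OF finite_X order_refl A(2)])
    fix x assume x: "x \<in> X"
    show "act n x = x" using hn(2) first_layer_stabD(2) x by blast
    have "sec n x = sec (inv h) (act m x) \<otimes> sec m x" unfolding n using A x by simp
    also have "\<dots> \<in> H0" using sec_m[OF x] H.sec_span[of "inv h" "act m x"] hn(1) A x by auto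
    finally show "sec n x \<in> H0 \<inter> derived A span" using hn(2) first_layer_stabD(3) x by blast
  qed blast
  then show ?thesis using hn by auto
qed

text \<open>
  If the sections gave all of \<open>G\<close>, then the rigid part \<open>L\<close> of \<open>M\<close> at the identity letter would be normal in
  \<open>G\<close>.  It is non-trivial by branching, and its copies at the other letters are obtained by rooted
  conjugation, so \<open>M\<close> would contain a non-trivial normal subgroup of \<open>G\<close>.
\<close>

lemma sections_ne_span:
  assumes M: "subgroup M A" "H0 \<subseteq> M" "M \<subseteq> span" "M \<noteq> span"
  shows "(\<lambda>m. sec m e) ` {m \<in> M. act m e = e} \<noteq> span"
proof
  assume eq: "(\<lambda>m. sec m e) ` {m \<in> M. act m e = e} = span"
  interpret M: subgroup M A by (rule M(1))
  define L where "L = {l \<in> carrier A. single e l \<in> M}"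
  have sL: "subgroup L A"
  proof (rule subgroup.intro)
    show "L \<subseteq> carrier A" unfolding L_def by blast
    show "\<one> \<in> L" by (simp add: L_def single_one)
    show "a \<otimes> b \<in> L" if "a \<in> L" "b \<in> L" for a b
      using that M.m_closed by (simp add: L_def single_mult)
    show "inv a \<in> L" if "a \<in> L" for a
      using that M.m_inv_closed by (simp add: L_def single_inv)
  qed
  have L_conj: "u \<otimes> l \<otimes> inv u \<in> L" if u: "u \<in> span" and l: "l \<in> L" for u l
  proof -
    obtain m where m: "m \<in> M" "act m e = e" "u = sec m e" using u unfolding eq[symmetric] by blast
    have lA: "l \<in> carrier A" "single e l \<in> M" using l unfolding L_def by blast+
    have "m \<otimes> single e l \<otimes> inv m \<in> M" using m lA by blast
    moreover have "m \<otimes> single e l \<otimes> inv m = single e (u \<otimes> l \<otimes> inv u)"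
      using conj_single[of m l e] m lA by simp
    ultimately show ?thesis using u lA by (simp add: L_def)
  qed
  let ?N = "span \<inter> first_layer_stab L"
  have N: "?N \<lhd> A\<lparr>carrier := span\<rparr>" by (rule first_layer_stab_normal[OF sL L_conj])
  obtain r where r: "r \<in> X" "r \<noteq> e" "rt r \<in> RGd" by (rule RGd_nontrivial)
  have "single e (rt r) \<in> Hd" using r RGd_sub by (intro single_Hd) blast
  then have s: "single e (rt r) \<in> H0" using Hd_sub by blast
  have "rt r \<in> L" using s M(2) r unfolding L_def by auto
  then have "single e (rt r) \<in> ?N"
    using s H0_sub single_first_layer_stab[OF subgroup.one_closed[OF sL] subgroup.subset[OF sL]] by blast
  moreover have "single e (rt r) \<noteq> \<one>"
  proof
    assume "single e (rt r) = \<one>"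
    then have "sec (single e (rt r)) e = sec \<one> e" by simp
    then have "rt r = rt e" using r rt_one by simp
    then show False using r rt_inj by blast
  qed
  ultimately have N1: "?N \<noteq> {\<one>}" by blast
  have single_M: "single x l \<in> M" if x: "x \<in> X" and l: "l \<in> L" for x l
  proof -
    have lA: "l \<in> carrier A" "single e l \<in> M" using l unfolding L_def by blast+
    have "rt x \<in> M" using H.RG_span[OF x] M(2) by blast
    then have "rt x \<otimes> single e l \<otimes> inv (rt x) \<in> M" using lA by blast
    then show ?thesis using conj_single[of "rt x" l e] x lA by simp
  qed
  have NM: "?N \<subseteq> M"
  proof
    fix f assume "f \<in> ?N"
    then have f: "f \<in> first_layer_stab L" by blast
    show "f \<in> M"
      by (rule mem_of_singles[OF M(1) subgroup.one_closed[OF sL] subgroup.subset[OF sL] single_M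
            first_layer_stabD(1)[OF f] first_layer_stabD(2)[OF f] first_layer_stabD(3)[OF f]])
  qed
  have "span \<subseteq> M"
  proof
    fix a assume "a \<in> span"
    then obtain h n where "h \<in> H0" "n \<in> ?N" "a = h \<otimes> n" using dense[OF N N1] by blast
    then show "a \<in> M" using NM M(2) by blast
  qed
  then show False using M(3,4) by blast
qed

lemma sections_H0:
  assumes "H0 \<subseteq> M" shows "H0 \<subseteq> (\<lambda>m. sec m e) ` {m \<in> M. act m e = e}"
proof
  fix u assume "u \<in> H0"
  then obtain h where h: "h \<in> H0" "act h e = e" "sec h e = u" by (rule fractal[OF _ R.one_closed])
  then have "h \<in> {m \<in> M. act m e = e}" using assms by blast
  then show "u \<in> (\<lambda>m. sec m e) ` {m \<in> M. act m e = e}" using h(3) by blast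
qed

lemma proper_overgroup_trivial:
  assumes T_max: "\<And>S. subgroup S A \<Longrightarrow> T \<subseteq> S \<Longrightarrow> S \<subseteq> D \<Longrightarrow> S = T \<or> S = D"
  shows "subgroup M A \<Longrightarrow> H0 \<subseteq> M \<Longrightarrow> M \<subseteq> span \<Longrightarrow> M \<noteq> span \<Longrightarrow> m \<in> M \<Longrightarrow> m \<in> level n nuc \<Longrightarrow> m \<in> H0"
proof (induction n arbitrary: M m)
  case 0
  then consider r where "r \<in> X" "m = rt r" | "m \<in> D" by (auto simp: nuc_def)
  then show ?case
  proof cases
    case 1
    then show ?thesis using H.RG_span by simp
  next
    case 2
    have "subgroup (M \<inter> D) A" by (rule subgroups_Inter_pair[OF 0(1) subgroup_D])
    moreover have "T \<subseteq> M \<inter> D" using 0(2) H.D_span T_sub_D by blast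
    ultimately have "M \<inter> D = T \<or> M \<inter> D = D" by (rule T_max) blast
    then show ?thesis
    proof
      assume "M \<inter> D = T"
      then show ?thesis using 2 0(5) H.D_span by blast
    next
      assume "M \<inter> D = D"
      then have "span \<subseteq> M" using 0(1,2) H.RG_span by (intro span_least) blast+
      then show ?thesis using 0(3,4) by blast
    qed
  qed
next
  case (Suc n)
  interpret M: subgroup M A by (rule Suc.prems(1))
  let ?Me = "(\<lambda>m. sec m e) ` {m \<in> M. act m e = e}"
  have mA: "m \<in> carrier A" using Suc.prems(5) by (rule M.mem_carrier)
  show ?case
  proof (rule mem_of_sections)
    show "m \<in> span" using Suc.prems(3,5) by blast
    fix x assume x: "x \<in> X"
    let ?y = "act m x"
    have y: "?y \<in> X" using mA x by (rule act_closed)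
    \<comment> \<open>Rooted factors move the section at \<open>x\<close> to the identity letter and stay inside \<open>M\<close>.\<close>
    let ?k = "inv (rt ?y) \<otimes> m \<otimes> rt x"
    have R_M: "rt r \<in> M" if "r \<in> X" for r using H.RG_span[OF that] Suc.prems(2) by blast
    have "?k \<in> M" using R_M[OF x] R_M[OF y] Suc.prems(5) by blast
    moreover have "act ?k e = e" using mA x y by simp
    ultimately have k: "?k \<in> {m \<in> M. act m e = e}" by blast
    have "sec ?k e = sec m x" using mA x y by simp
    then have "sec m x \<in> ?Me" using k by (metis (no_types, lifting) rev_image_eqI)
    moreover have "sec m x \<in> level n nuc" using Suc.prems(6) x unfolding level.simps by blast
    moreover have "subgroup ?Me A" by (rule subgroup_sections[OF Suc.prems(1) R.one_closed])
    moreover have "?Me \<subseteq> span" using Suc.prems(3) sec_span by blast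
    ultimately show "sec m x \<in> H0"
      using sections_ne_span[OF Suc.prems(1-4)] sections_H0[OF Suc.prems(2)]
      by (intro Suc.IH[of ?Me])
  qed
qed

lemma H0_maximal:
  assumes T_max: "\<And>S. subgroup S A \<Longrightarrow> T \<subseteq> S \<Longrightarrow> S \<subseteq> D \<Longrightarrow> S = T \<or> S = D"
    and M: "subgroup M A" "H0 \<subseteq> M" "M \<subseteq> span"
  shows "M = H0 \<or> M = span"
proof (rule disjCI)
  assume ne: "M \<noteq> span"
  have "M \<subseteq> H0"
  proof
    fix m assume m: "m \<in> M"
    then obtain n where "m \<in> level n nuc" using M(3) span_deep unfolding deep_def by blast
    then show "m \<in> H0" using proper_overgroup_trivial[OF T_max M ne m] by blast
  qed
  then show "M = H0" using M(2) by blast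
qed

end

section \<open>Tree automorphisms as a first-layer recursion\<close>

lemma carrier_tree_Aut [simp]: "carrier (tree_Aut X) = tree_auto X"
  by (simp add: tree_Aut_def)

lemma tree_auto_Bij: "g \<in> tree_auto X \<Longrightarrow> g \<in> Bij (lists X)"
  by (simp add: tree_auto_def)

lemma BijI:
  assumes "f \<in> extensional S" "\<And>w. w \<in> S \<Longrightarrow> f w \<in> S"
    "\<And>u v. u \<in> S \<Longrightarrow> v \<in> S \<Longrightarrow> f u = f v \<Longrightarrow> u = v" "\<And>u. u \<in> S \<Longrightarrow> \<exists>w \<in> S. f w = u"
  shows "f \<in> Bij S"
proof -
  have "inj_on f S" using assms(3) by (rule inj_onI)
  moreover have "f ` S = S" using assms(2,4) by blast
  ultimately show ?thesis using assms(1) by (simp add: Bij_def bij_betw_def)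
qed

lemma tree_auto_surj:
  assumes "g \<in> tree_auto X" "u \<in> lists X"
  obtains w where "w \<in> lists X" "g w = u"
proof -
  have "g ` lists X = lists X" using tree_auto_Bij[OF assms(1)] by (simp add: Bij_def bij_betw_def)
  then have "u \<in> g ` lists X" using assms(2) by (simp only:)
  then show thesis by (rule imageE) (rule that, simp_all)
qed

lemma tree_auto_Nil: "g \<in> tree_auto X \<Longrightarrow> g [] = []"
  by (simp add: tree_auto_def)

lemma tree_auto_ext:
  assumes "g \<in> tree_auto X" "h \<in> tree_auto X" "\<And>w. w \<in> lists X \<Longrightarrow> g w = h w"
  shows "g = h"
proof (rule extensionalityI[of _ "lists X"])
  show "g \<in> extensional (lists X)" "h \<in> extensional (lists X)"
    using tree_auto_Bij[OF assms(1)] tree_auto_Bij[OF assms(2)] by (simp_all add: Bij_def)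
qed (rule assms(3))

lemma tree_mult_apply:
  "g \<in> tree_auto X \<Longrightarrow> h \<in> tree_auto X \<Longrightarrow> w \<in> lists X \<Longrightarrow> (g \<otimes>\<^bsub>tree_Aut X\<^esub> h) w = g (h w)"
  using tree_auto_Bij[of g X] tree_auto_Bij[of h X] by (simp add: tree_Aut_def BijGroup_def compose_def)

lemma tree_one_apply: "w \<in> lists X \<Longrightarrow> \<one>\<^bsub>tree_Aut X\<^esub> w = w"
  by (simp add: tree_Aut_def BijGroup_def)

lemma tree_auto_singleton:
  assumes "g \<in> tree_auto X" "x \<in> X"
  shows "g [x] = [hd (g [x])]" "hd (g [x]) \<in> X"
proof -
  have x: "[x] \<in> lists X" using assms(2) by simp
  have "length (g [x]) = 1" using tree_auto_length[OF assms(1) x] by simp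
  then obtain y where y: "g [x] = [y]" by (auto simp: length_Suc_conv)
  then show "g [x] = [hd (g [x])]" by simp
  show "hd (g [x]) \<in> X" using tree_auto_lists[OF assms(1) x] y by simp
qed

lemma tree_auto_Cons:
  assumes "g \<in> tree_auto X" "x \<in> X" "w \<in> lists X"
  shows "g (x # w) = hd (g [x]) # tree_section X g [x] w"
proof -
  obtain y where y: "g [x] = [y]" using tree_auto_singleton(1)[OF assms(1,2)] by blast
  show ?thesis using tree_section_eq[OF assms(1), of "[x]" w] assms(2,3) unfolding y by simp
qed

lemma tree_adj_simps [simp]:
  "tree_adj (x # u) (y # v) \<longleftrightarrow> x = y \<and> tree_adj u v"
  "tree_adj [] (y # v) \<longleftrightarrow> v = []"
  "tree_adj (x # u) [] \<longleftrightarrow> u = []"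
  "\<not> tree_adj [] []"
  by (simp_all add: tree_adj_def) blast

lemma hd_tree_auto_inj:
  assumes g: "g \<in> tree_auto X" and "x \<in> X" "y \<in> X" "hd (g [x]) = hd (g [y])"
  shows "x = y"
proof -
  have "g [x] = g [y]" using assms tree_auto_singleton(1)[OF g] by metis
  then show ?thesis using tree_auto_inj[OF g, of "[x]" "[y]"] assms(2,3) by simp
qed

lemma tree_section_closed:
  assumes g: "g \<in> tree_auto X" and x: "x \<in> X"
  shows "tree_section X g [x] \<in> tree_auto X"
proof -
  let ?s = "tree_section X g [x]"
  note Cons = tree_auto_Cons[OF g x]
  have mem: "?s w \<in> lists X" if "w \<in> lists X" for w
    using tree_auto_lists[OF g, of "x # w"] x that unfolding Cons[OF that] by simp
  have inj: "u = v" if "u \<in> lists X" "v \<in> lists X" "?s u = ?s v" for u v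
  proof -
    have "g (x # u) = g (x # v)" using that(3) unfolding Cons[OF that(1)] Cons[OF that(2)] by simp
    then show ?thesis using tree_auto_inj[OF g, of "x # u" "x # v"] x that by simp
  qed
  have surj: "\<exists>w \<in> lists X. ?s w = u" if u: "u \<in> lists X" for u
  proof -
    have "hd (g [x]) # u \<in> lists X" using u tree_auto_singleton(2)[OF g x] by simp
    then obtain v where v: "v \<in> lists X" "g v = hd (g [x]) # u" by (rule tree_auto_surj[OF g])
    then obtain y w where yw: "v = y # w" using tree_auto_Nil[OF g] by (cases v) auto
    then have yX: "y \<in> X" and wX: "w \<in> lists X" using v(1) by simp_all
    have "hd (g [y]) # tree_section X g [y] w = hd (g [x]) # u"
      using v(2) tree_auto_Cons[OF g yX wX] yw by simp
    then have eq: "hd (g [y]) = hd (g [x])" "tree_section X g [y] w = u" by blast+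
    have "y = x" by (rule hd_tree_auto_inj[OF g yX x eq(1)])
    then show ?thesis using eq(2) wX by blast
  qed
  have "?s \<in> Bij (lists X)"
    using mem inj surj by (intro BijI) (auto simp only: tree_section_def restrict_extensional)
  moreover have "?s [] = []"
  proof -
    obtain y where "g [x] = [y]" using tree_auto_singleton(1)[OF g x] by blast
    then show ?thesis by (simp add: tree_section_def)
  qed
  moreover have "tree_adj (?s u) (?s v) \<longleftrightarrow> tree_adj u v" if "u \<in> lists X" "v \<in> lists X" for u v
  proof -
    have "tree_adj (g (x # u)) (g (x # v)) \<longleftrightarrow> tree_adj (x # u) (x # v)"
      using g x that unfolding tree_auto_def by (auto simp del: tree_adj_simps)
    then show ?thesis unfolding Cons[OF that(1)] Cons[OF that(2)] by simp
  qed
  ultimately show ?thesis by (simp add: tree_auto_def)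
qed

text \<open>
  The common source of the rooted automorphisms and of \<open>first_layer\<close>, which are assembled in this way from
  a permutation of the letters and a family of automorphisms.
\<close>

lemma tree_auto_of_sections:
  assumes p: "bij_betw p X X" and k: "\<And>x. x \<in> X \<Longrightarrow> k x \<in> tree_auto X"
    and f: "f \<in> extensional (lists X)" "f [] = []"
    and f_Cons: "\<And>x w. x \<in> X \<Longrightarrow> w \<in> lists X \<Longrightarrow> f (x # w) = p x # k x w"
  shows "f \<in> tree_auto X"
proof -
  have pX: "p x \<in> X" if "x \<in> X" for x using p that by (auto simp: bij_betw_def)
  have p_inj: "p x = p y \<longleftrightarrow> x = y" if "x \<in> X" "y \<in> X" for x y
    using p that by (auto simp: bij_betw_def dest: inj_onD)
  have mem: "f w \<in> lists X" if "w \<in> lists X" for w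
    using that f(2) f_Cons pX tree_auto_lists[OF k] by (cases w) auto
  have inj: "u = v" if uv: "u \<in> lists X" "v \<in> lists X" "f u = f v" for u v
  proof (cases u)
    case Nil
    then show ?thesis using uv f(2) f_Cons by (cases v) auto
  next
    case u: (Cons x u')
    show ?thesis
    proof (cases v)
      case Nil
      then show ?thesis using u uv f(2) f_Cons by auto
    next
      case v: (Cons y v')
      have X: "x \<in> X" "y \<in> X" "u' \<in> lists X" "v' \<in> lists X" using uv u v by simp_all
      then have "p x = p y" "k x u' = k y v'" using uv(3) f_Cons u v by simp_all
      then show ?thesis using u v p_inj X tree_auto_inj[OF k[OF X(1)] X(3,4)] by simp
    qed
  qed
  have surj: "\<exists>w \<in> lists X. f w = u" if u: "u \<in> lists X" for u
  proof (cases u)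
    case Nil
    then show ?thesis using f(2) by auto
  next
    case (Cons y v)
    then have yv: "y \<in> X" "v \<in> lists X" using u by simp_all
    have "y \<in> p ` X" using yv(1) p by (simp add: bij_betw_def)
    then obtain x where x: "x \<in> X" "p x = y" by (rule imageE) (rule that, simp_all)
    obtain w where w: "w \<in> lists X" "k x w = v" by (rule tree_auto_surj[OF k[OF x(1)] yv(2)])
    have "f (x # w) = u" using f_Cons[OF x(1) w(1)] x w Cons by simp
    moreover have "x # w \<in> lists X" using x w by simp
    ultimately show ?thesis by blast
  qed
  have "f \<in> Bij (lists X)" using f(1) mem inj surj by (rule BijI)
  moreover have "tree_adj (f u) (f v) \<longleftrightarrow> tree_adj u v" if uv: "u \<in> lists X" "v \<in> lists X" for u v
  proof (cases u; cases v)
    fix x u' y v' assume Cons: "u = x # u'" "v = y # v'"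
    have "tree_adj (k x u') (k x v') \<longleftrightarrow> tree_adj u' v'"
      using k[of x] uv Cons unfolding tree_auto_def by auto
    then show ?thesis using uv Cons f_Cons p_inj by auto
  next
    fix y v' assume "u = []" "v = y # v'"
    then show ?thesis using uv f f_Cons tree_auto_length[OF k, of y v'] by auto
  next
    fix x u' assume "u = x # u'" "v = []"
    then show ?thesis using uv f f_Cons tree_auto_length[OF k, of x u'] by auto
  qed (use f in simp_all)
  ultimately show ?thesis using f(2) by (simp add: tree_auto_def)
qed

lemma wreath_recursion_tree:
  assumes R: "group R" "finite (carrier R)"
  shows "wreath_recursion (tree_Aut (carrier R)) R (\<lambda>g x. hd (g [x]))
     (\<lambda>g x. tree_section (carrier R) g [x]) (first_layer (carrier R)) (rooted R)"
proof -
  interpret R: group R by (rule R)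
  let ?X = "carrier R" and ?A = "tree_Aut (carrier R)"
  interpret A: group ?A by (rule group_tree_Aut)
  have mult: "g \<otimes>\<^bsub>?A\<^esub> h \<in> tree_auto ?X" if "g \<in> tree_auto ?X" "h \<in> tree_auto ?X" for g h
    using A.m_closed[of g h] that by simp
  have one: "\<one>\<^bsub>?A\<^esub> \<in> tree_auto ?X" using A.one_closed by simp
  have fl: "first_layer ?X k \<in> tree_auto ?X" if "\<And>x. x \<in> ?X \<Longrightarrow> k x \<in> tree_auto ?X" for k
  proof (rule tree_auto_of_sections[of "\<lambda>x. x" _ k])
    show "bij_betw (\<lambda>x. x) ?X ?X" by (simp add: bij_betw_def)
  qed (use that in \<open>auto simp: first_layer_def\<close>)
  have rt: "rooted R r \<in> tree_auto ?X" if r: "r \<in> ?X" for r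
  proof (rule tree_auto_of_sections[of "\<lambda>x. r \<otimes>\<^bsub>R\<^esub> x" _ "\<lambda>_. \<one>\<^bsub>?A\<^esub>"])
    show "bij_betw (\<lambda>x. r \<otimes>\<^bsub>R\<^esub> x) ?X ?X"
      by (rule bij_betwI[where g = "\<lambda>x. inv\<^bsub>R\<^esub> r \<otimes>\<^bsub>R\<^esub> x"]) (use r in \<open>auto simp: R.m_assoc[symmetric]\<close>)
  qed (use one r in \<open>auto simp: rooted_def tree_one_apply\<close>)
  show ?thesis
  proof unfold_locales
    show "finite ?X" by (rule R(2))
    fix g h :: "'a list \<Rightarrow> 'a list" and x
    assume "g \<in> carrier ?A" and x: "x \<in> ?X"
    then have g: "g \<in> tree_auto ?X" by simp
    show "hd (g [x]) \<in> ?X" by (rule tree_auto_singleton(2)[OF g x])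
    show "tree_section ?X g [x] \<in> carrier ?A" using tree_section_closed[OF g x] by simp
    assume "h \<in> carrier ?A"
    then have h: "h \<in> tree_auto ?X" by simp
    have hx: "h [x] = [hd (h [x])]" "hd (h [x]) \<in> ?X" by (rule tree_auto_singleton[OF h x])+
    show "hd ((g \<otimes>\<^bsub>?A\<^esub> h) [x]) = hd (g [hd (h [x])])"
    proof -
      have "(g \<otimes>\<^bsub>?A\<^esub> h) [x] = g (h [x])" using x by (intro tree_mult_apply[OF g h]) simp
      also have "\<dots> = g [hd (h [x])]" by (rule arg_cong[OF hx(1)])
      finally show ?thesis by (rule arg_cong)
    qed
    show "tree_section ?X (g \<otimes>\<^bsub>?A\<^esub> h) [x]
      = tree_section ?X g [hd (h [x])] \<otimes>\<^bsub>?A\<^esub> tree_section ?X h [x]"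
    proof (rule tree_auto_ext)
      show "tree_section ?X (g \<otimes>\<^bsub>?A\<^esub> h) [x] \<in> tree_auto ?X"
        by (rule tree_section_closed[OF mult[OF g h] x])
      show "tree_section ?X g [hd (h [x])] \<otimes>\<^bsub>?A\<^esub> tree_section ?X h [x] \<in> tree_auto ?X"
        by (rule mult[OF tree_section_closed[OF g hx(2)] tree_section_closed[OF h x]])
      fix w assume w: "w \<in> lists ?X"
      let ?u = "tree_section ?X h [x] w"
      have u: "?u \<in> lists ?X" by (rule tree_auto_lists[OF tree_section_closed[OF h x] w])
      have "(g \<otimes>\<^bsub>?A\<^esub> h) (x # w) = g (h (x # w))" using x w by (intro tree_mult_apply[OF g h]) simp
      also have "\<dots> = g (hd (h [x]) # ?u)" using tree_auto_Cons[OF h x w] by simp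
      also have "\<dots> = hd (g [hd (h [x])]) # tree_section ?X g [hd (h [x])] ?u"
        by (rule tree_auto_Cons[OF g hx(2) u])
      finally have "tree_section ?X (g \<otimes>\<^bsub>?A\<^esub> h) [x] w = tree_section ?X g [hd (h [x])] ?u"
        using tree_auto_Cons[OF mult[OF g h] x w] by simp
      then show "tree_section ?X (g \<otimes>\<^bsub>?A\<^esub> h) [x] w
        = (tree_section ?X g [hd (h [x])] \<otimes>\<^bsub>?A\<^esub> tree_section ?X h [x]) w"
        using tree_mult_apply[OF tree_section_closed[OF g hx(2)] tree_section_closed[OF h x] w] by simp
    qed
  next
    fix x assume "x \<in> ?X"
    then show "hd (\<one>\<^bsub>?A\<^esub> [x]) = x" by (simp add: tree_one_apply)
  next
    fix g h :: "'a list \<Rightarrow> 'a list"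
    assume "g \<in> carrier ?A" "h \<in> carrier ?A"
      and eq: "\<And>x. x \<in> ?X \<Longrightarrow> hd (g [x]) = hd (h [x])"
        "\<And>x. x \<in> ?X \<Longrightarrow> tree_section ?X g [x] = tree_section ?X h [x]"
    then have gh: "g \<in> tree_auto ?X" "h \<in> tree_auto ?X" by simp_all
    show "g = h"
    proof (rule tree_auto_ext[OF gh])
      fix w assume w: "w \<in> lists ?X"
      show "g w = h w"
      proof (cases w)
        case Nil
        then show ?thesis using tree_auto_Nil[OF gh(1)] tree_auto_Nil[OF gh(2)] by simp
      next
        case (Cons x u)
        then have xu: "x \<in> ?X" "u \<in> lists ?X" using w by simp_all
        show ?thesis
          unfolding Cons tree_auto_Cons[OF gh(1) xu] tree_auto_Cons[OF gh(2) xu]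
            eq(1)[OF xu(1)] eq(2)[OF xu(1)] ..
      qed
    qed
  next
    fix k :: "'a \<Rightarrow> 'a list \<Rightarrow> 'a list"
    assume k: "\<And>x. x \<in> ?X \<Longrightarrow> k x \<in> carrier ?A"
    then show "first_layer ?X k \<in> carrier ?A" using fl by simp
    fix y assume y: "y \<in> ?X"
    show "hd (first_layer ?X k [y]) = y" using y by (simp add: first_layer_def)
    have ky: "k y \<in> tree_auto ?X" using k[OF y] by simp
    show "tree_section ?X (first_layer ?X k) [y] = k y"
    proof (rule extensionalityI[of _ "lists ?X"])
      show "k y \<in> extensional (lists ?X)" using tree_auto_Bij[OF ky] by (simp add: Bij_def)
    qed (use y in \<open>auto simp: tree_section_def first_layer_def\<close>)
  next
    fix r assume r: "r \<in> ?X"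
    then show "rooted R r \<in> carrier ?A" using rt by simp
    fix x assume x: "x \<in> ?X"
    show "hd (rooted R r [x]) = r \<otimes>\<^bsub>R\<^esub> x" using x by (simp add: rooted_def)
    show "tree_section ?X (rooted R r) [x] = \<one>\<^bsub>?A\<^esub>"
    proof (rule extensionalityI[of _ "lists ?X"])
      show "\<one>\<^bsub>?A\<^esub> \<in> extensional (lists ?X)" using tree_auto_Bij[OF one] by (simp add: Bij_def)
    qed (use x in \<open>auto simp: tree_section_def rooted_def tree_one_apply\<close>)
  qed
qed

lemma directed_group_tree:
  assumes R: "group R" "finite (carrier R)"
    and D: "subgroup D (tree_Aut (carrier R))" "\<And>d. d \<in> D \<Longrightarrow> directed R d"
  shows "directed_group (tree_Aut (carrier R)) R (\<lambda>g x. hd (g [x]))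
     (\<lambda>g x. tree_section (carrier R) g [x]) (first_layer (carrier R)) (rooted R) D"
proof -
  let ?X = "carrier R" and ?A = "tree_Aut (carrier R)"
  interpret wreath_recursion ?A R "\<lambda>g x. hd (g [x])" "\<lambda>g x. tree_section ?X g [x]"
    "first_layer ?X" "rooted R" by (rule wreath_recursion_tree[OF R])
  show ?thesis
  proof (rule directed_group.intro[OF wreath_recursion_axioms], rule directed_group_axioms.intro)
    show "subgroup D ?A" by (rule D(1))
    fix d assume d: "d \<in> D"
    note dir = D(2)[OF d]
    show "hd (d [x]) = x" if "x \<in> ?X" for x using dir that by (simp add: directed_def)
    show "tree_section ?X d [\<one>\<^bsub>R\<^esub>] = d" using dir by (simp add: directed_def)
    show "tree_section ?X d [x] \<in> rooted R ` ?X" if "x \<in> ?X" "x \<noteq> \<one>\<^bsub>R\<^esub>" for x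
      using dir that by (simp add: directed_def rooted_group_def)
    assume triv: "\<And>x. x \<in> ?X \<Longrightarrow> x \<noteq> \<one>\<^bsub>R\<^esub> \<Longrightarrow> tree_section ?X d [x] = \<one>\<^bsub>?A\<^esub>"
    have dX: "d \<in> tree_auto ?X" using dir by (simp add: directed_def)
    show "d = \<one>\<^bsub>?A\<^esub>"
    proof (rule tree_auto_ext[OF dX])
      show "\<one>\<^bsub>?A\<^esub> \<in> tree_auto ?X" using one_closed by simp
      show "d w = \<one>\<^bsub>?A\<^esub> w" if "w \<in> lists ?X" for w
        using that
      proof (induction w)
        case Nil
        then show ?case using tree_auto_Nil[OF dX] by (simp add: tree_one_apply)
      next
        case (Cons x w)
        have "d (x # w) = x # tree_section ?X d [x] w"
          using tree_auto_Cons[OF dX Cons.hyps(1), of w] Cons.hyps dir by (simp add: directed_def)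
        also have "tree_section ?X d [x] w = w"
          using triv[of x] Cons dir by (cases "x = \<one>\<^bsub>R\<^esub>") (auto simp: directed_def tree_one_apply)
        finally show ?case using Cons.hyps by (simp add: tree_one_apply)
      qed
    qed
  qed
qed

section \<open>The maximality criterion\<close>

theorem mainTheorem3:
  fixes R :: "('a, 'm) monoid_scheme"
    and D T H :: "('a list \<Rightarrow> 'a list) set"
  assumes "constant_spinal R D"
    and "special_from R D T H"
    and "prodense H (spinal_group R D)"
    and "regular_branch_over (carrier R) H (derived (tree_Aut (carrier R)) H)"
  shows "maximal_subgroup H (spinal_group R D) \<longleftrightarrow>
         maximal_subgroup T (tree_Aut (carrier R)\<lparr>carrier := D\<rparr>)"
proof -
  let ?X = "carrier R"
  define A where "A = tree_Aut (carrier R)"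
  let ?act = "\<lambda>g x. hd (g [x])" and ?sec = "\<lambda>g x. tree_section (carrier R) g [x]"
  have R: "group R" "finite ?X" and D: "subgroup D A" "\<And>d. d \<in> D \<Longrightarrow> directed R d"
    using assms(1) unfolding constant_spinal_def A_def by blast+
  interpret A: group A unfolding A_def by (rule group_tree_Aut)
  obtain g where T: "subgroup T (A\<lparr>carrier := D\<rparr>)" and genT: "Gen R T"
    and g: "g \<in> carrier (spinal_group R D)"
    and H: "H = g <#\<^bsub>spinal_group R D\<^esub> spinal_set R T #>\<^bsub>spinal_group R D\<^esub> inv\<^bsub>spinal_group R D\<^esub> g"
    using assms(2) unfolding special_from_def A_def by blast
  have TA: "subgroup T A" by (rule A.incl_subgroup[OF D(1) T])
  have TD: "T \<subseteq> D" using subgroup.subset[OF T] by simp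
  have dT: "directed R t" if "t \<in> T" for t using D(2) TD that by blast
  interpret G: directed_group A R ?act ?sec "first_layer ?X" "rooted R" D
    unfolding A_def by (rule directed_group_tree[OF R D[unfolded A_def]])
  interpret H: directed_group A R ?act ?sec "first_layer ?X" "rooted R" T
    unfolding A_def by (rule directed_group_tree[OF R TA[unfolded A_def] dT])
  interpret P: special_pair A R ?act ?sec "first_layer ?X" "rooted R" D T
    by unfold_locales (use TD genT in \<open>auto simp: Gen_def rooted_group_def A_def\<close>)
  have spinal_D: "spinal_set R D = G.span" and spinal_T: "spinal_set R T = H.span"
    unfolding G.span_def H.span_def G.nuc_def H.nuc_def
    by (simp_all add: spinal_set_def rooted_group_def A_def)
  have group_D: "spinal_group R D = A\<lparr>carrier := G.span\<rparr>"
    by (simp add: spinal_group_def spinal_D A_def)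
  have gG: "g \<in> G.span" using g by (simp add: group_D)
  have gA: "g \<in> carrier A" using gG by simp
  let ?c = "\<lambda>k. g \<otimes>\<^bsub>A\<^esub> k \<otimes>\<^bsub>A\<^esub> inv\<^bsub>A\<^esub> g"
  have H_conj: "H = ?c ` H.span"
    unfolding H spinal_T group_D using gG
    by (auto simp: l_coset_def r_coset_def A.m_inv_consistent[OF G.subgroup_span])
  have sH: "subgroup H A" unfolding H_conj by (rule A.subgroup_conj[OF H.subgroup_span gA])
  have H0_conj: "(\<lambda>k. inv\<^bsub>A\<^esub> g \<otimes>\<^bsub>A\<^esub> k \<otimes>\<^bsub>A\<^esub> inv\<^bsub>A\<^esub> (inv\<^bsub>A\<^esub> g)) ` H = H.span"
    unfolding H_conj by (rule A.conj_conj_inv[OF gA H.span.subset])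
  have max_H: "maximal_subgroup H (spinal_group R D) \<longleftrightarrow> maximal_subgroup H.span (A\<lparr>carrier := G.span\<rparr>)"
  proof
    assume "maximal_subgroup H (spinal_group R D)"
    then have "maximal_subgroup H (A\<lparr>carrier := G.span\<rparr>)" by (simp only: group_D)
    from A.maximal_subgroup_conj[OF G.subgroup_span G.span.m_inv_closed[OF gG] this]
    show "maximal_subgroup H.span (A\<lparr>carrier := G.span\<rparr>)" unfolding H0_conj .
  next
    assume "maximal_subgroup H.span (A\<lparr>carrier := G.span\<rparr>)"
    from A.maximal_subgroup_conj[OF G.subgroup_span gG this]
    show "maximal_subgroup H (spinal_group R D)" unfolding H_conj[symmetric] group_D .
  qed
  show ?thesis
    unfolding max_H A_def[symmetric] A.maximal_subgroup_restrict[OF G.subgroup_span]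
      A.maximal_subgroup_restrict[OF D(1)]
  proof (intro iffI conjI allI impI)
    assume max: "subgroup H.span A \<and> H.span \<subseteq> G.span \<and> H.span \<noteq> G.span \<and>
      (\<forall>L. subgroup L A \<longrightarrow> H.span \<subseteq> L \<longrightarrow> L \<subseteq> G.span \<longrightarrow> L = H.span \<or> L = G.span)"
    show "subgroup T A" "T \<subseteq> D" by (rule TA TD)+
    show "T \<noteq> D" using max by blast
    show "S = T \<or> S = D" if "subgroup S A" "T \<subseteq> S" "S \<subseteq> D" for S
      by (rule P.T_maximal) (use max that in blast)+
  next
    assume max: "subgroup T A \<and> T \<subseteq> D \<and> T \<noteq> D \<and>
      (\<forall>L. subgroup L A \<longrightarrow> T \<subseteq> L \<longrightarrow> L \<subseteq> D \<longrightarrow> L = T \<or> L = D)"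
    show "subgroup H.span A" "H.span \<subseteq> G.span" by (rule H.subgroup_span P.H0_sub)+
    show "H.span \<noteq> G.span"
    proof
      assume eq: "H.span = G.span"
      have "D \<subseteq> D \<inter> H.span" using G.D_span unfolding eq by blast
      then show False using P.D_Int_H0 max by blast
    qed
    show "M = H.span \<or> M = G.span" if M: "subgroup M A" "H.span \<subseteq> M" "M \<subseteq> G.span" for M
    proof -
      have dense: "\<exists>h \<in> H.span. \<exists>n \<in> N. a = h \<otimes>\<^bsub>A\<^esub> n"
        if N: "N \<lhd> A\<lparr>carrier := G.span\<rparr>" "N \<noteq> {\<one>\<^bsub>A\<^esub>}" and a: "a \<in> G.span" for N a
      proof -
        interpret N: normal N "A\<lparr>carrier := G.span\<rparr>" by (rule N(1))
        have NG: "N \<subseteq> G.span" using N.subset by simp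
        have "H <#>\<^bsub>spinal_group R D\<^esub> N = carrier (spinal_group R D)"
          using assms(3) N unfolding prodense_def group_D by simp
        moreover have "?c a \<in> G.span" using a gG by blast
        ultimately have "?c a \<in> H <#>\<^bsub>A\<^esub> N" unfolding group_D by (simp add: set_mult_def)
        then obtain h n where h: "h \<in> H.span" and n: "n \<in> N" and eq: "?c a = ?c h \<otimes>\<^bsub>A\<^esub> n"
          unfolding H_conj set_mult_def by blast
        let ?n = "inv\<^bsub>A\<^esub> g \<otimes>\<^bsub>A\<^esub> n \<otimes>\<^bsub>A\<^esub> g"
        have "?n \<in> N"
          using N.inv_op_closed1[of g n] n gG by (simp add: A.m_inv_consistent[OF G.subgroup_span])
        moreover have "a = h \<otimes>\<^bsub>A\<^esub> ?n"
        proof -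
          have cl: "a \<in> carrier A" "h \<in> carrier A" "n \<in> carrier A" using a h n NG by auto
          have "a = inv\<^bsub>A\<^esub> g \<otimes>\<^bsub>A\<^esub> ?c a \<otimes>\<^bsub>A\<^esub> g"
            using gA cl by (simp add: A.m_assoc) (simp add: A.m_assoc[symmetric])
          also have "\<dots> = h \<otimes>\<^bsub>A\<^esub> ?n"
            unfolding eq using gA cl by (simp add: A.m_assoc) (simp add: A.m_assoc[symmetric])
          finally show ?thesis .
        qed
        ultimately show ?thesis using h by blast
      qed
      interpret B: dense_pair A R ?act ?sec "first_layer ?X" "rooted R" D T
      proof (rule dense_pair.intro[OF P.special_pair_axioms], rule dense_pair_axioms.intro)
        show "T \<noteq> D" using max by (elim conjE)
      qed (rule dense)
      let ?Hg = "?c ` P.Hd"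
      have rb: "finite_index (A\<lparr>carrier := H\<rparr>) (derived A H)"
        "finite_index (A\<lparr>carrier := derived A H\<rparr>) {first_layer ?X k |k. \<forall>x \<in> ?X. k x \<in> derived A H}"
        using assms(4) unfolding regular_branch_over_def A_def by blast+
      have Hg: "derived A H = ?Hg"
      proof -
        interpret c: group_hom A A ?c
          using gA A.conj_mult[OF gA] by unfold_locales (simp add: hom_def)
        show ?thesis unfolding H_conj by (rule c.derived_img[OF H.span.subset])
      qed
      have sHg: "subgroup ?Hg A" by (rule A.subgroup_conj[OF P.Hd.subgroup_axioms gA])
      interpret Hg: subgroup ?Hg A by (rule sHg)
      have fl: "{first_layer ?X k |k. \<forall>x \<in> ?X. k x \<in> ?Hg} = G.first_layer_stab ?Hg"
      proof (intro equalityI subsetI)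
        fix f assume "f \<in> {first_layer ?X k |k. \<forall>x \<in> ?X. k x \<in> ?Hg}"
        then obtain k where f: "f = first_layer ?X k" and k: "\<And>x. x \<in> ?X \<Longrightarrow> k x \<in> ?Hg" by blast
        have kA: "k x \<in> carrier A" if "x \<in> ?X" for x by (rule Hg.mem_carrier[OF k[OF that]])
        show "f \<in> G.first_layer_stab ?Hg"
        proof (rule G.first_layer_stabI)
          show "f \<in> carrier A" unfolding f by (rule G.fl_closed[OF kA])
          fix x assume x: "x \<in> ?X"
          show "?act f x = x" unfolding f by (rule G.act_fl[OF kA x])
          have "?sec f x = k x" unfolding f by (rule G.sec_fl[OF kA x])
          then show "?sec f x \<in> ?Hg" using k[OF x] by (simp only:)
        qed
      next
        fix f assume f: "f \<in> G.first_layer_stab ?Hg"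
        note D = G.first_layer_stabD[OF f]
        have sec_A: "?sec f x \<in> carrier A" if "x \<in> ?X" for x by (rule Hg.mem_carrier[OF D(3)[OF that]])
        have "f = first_layer ?X (?sec f)"
        proof (rule G.wreath_eqI[OF D(1) G.fl_closed[OF sec_A]])
          fix x assume x: "x \<in> ?X"
          show "?act f x = ?act (first_layer ?X (?sec f)) x"
            by (rule trans[OF D(2)[OF x] G.act_fl[OF sec_A x, symmetric]])
          show "?sec f x = ?sec (first_layer ?X (?sec f)) x"
            by (rule G.sec_fl[OF sec_A x, symmetric])
        qed
        then show "f \<in> {first_layer ?X k |k. \<forall>x \<in> ?X. k x \<in> ?Hg}" using D(3) by blast
      qed
      interpret C: branch_pair A R ?act ?sec "first_layer ?X" "rooted R" D T g ?Hg
      proof unfold_locales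
        show "g \<in> G.span" by (rule gG)
        show "?Hg = ?Hg" ..
        show "G.first_layer_stab ?Hg \<subseteq> ?Hg"
          using rb(2) subgroup.subset unfolding finite_index_def Hg fl by fastforce
        show "\<exists>b \<ge> 1. ?c h [^]\<^bsub>A\<^esub> (b::nat) \<in> ?Hg" if "h \<in> H.span" for h
        proof -
          have "?c h \<in> carrier (A\<lparr>carrier := H\<rparr>)" using that unfolding H_conj by simp
          from group.finite_index_pow[OF A.subgroup_imp_group[OF sH] rb(1) this]
          show ?thesis unfolding Hg A.nat_pow_consistent[symmetric] by blast
        qed
        show "\<exists>b \<ge> 1. k [^]\<^bsub>A\<^esub> (b::nat) \<in> G.first_layer_stab ?Hg" if "k \<in> ?Hg" for k
        proof -
          have "k \<in> carrier (A\<lparr>carrier := ?Hg\<rparr>)" using that by simp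
          from group.finite_index_pow[OF A.subgroup_imp_group[OF sHg] rb(2)[unfolded Hg fl] this]
          show ?thesis unfolding A.nat_pow_consistent[symmetric] by blast
        qed
      qed
      show ?thesis by (rule C.H0_maximal[OF _ M]) (use max in blast)
    qed
  qed
qed

end
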